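(* Let $(F,d)$ be an ordinary differential field of characteristic zero with constant field $C\neq F$, let $n>1$, let $H$ be a subgroup of $GL(n,C)\propto C^n$, and let $p^d\langle x\rangle\in C\langle x,d\rangle$ be a fixed nonzero element such that $p^{g^{-1}d}\langle hx+h_0\rangle=g^{-1}p^d\langle x\rangle$ for all $g\in F^*$, $(h,h_0)\in H$. Put $\delta=p^d\langle x\rangle^{-1}d$. Then the differential transcendence degree of the $\delta$-differential field $C\langle x,d\rangle^{(F^*,H)}$ over $C$ is $$\delta\text{-}\mathrm{tr.deg}\; C\langle x,d\rangle^{(F^*,H)}/C=n-1 .$$
   Context: $GL(n,C)\propto C^n$ is the affine group; $(h,h_0)$ acts on column vectors by $x\mapsto hx+h_0$. $F^*=F\setminus\{0\}$. $x$ is the column vector of $x_1,\dots,x_n$, which are $d$-differentially algebraically independent over $F$. $C\{x,d\}=C[x,dx,d^2x,\dots]$ is the ring of differential polynomials in $x_1,\dots,x_n$ over $C$ and $C\langle x,d\rangle$ is its field of fractions (differential rational functions). For $f^d\langle x\rangle\in C\langle x,d\rangle$ and $g\in F^*$, $f^{g^{-1}d}\langle hx+h_0\rangle$ is the result of replacing $x$ by $hx+h_0$ and $d$ by $g^{-1}d$ in $f$. $C\langle x,d\rangle^{(F^*,H)}$ is the field of all $f^d\langle x\rangle\in C\langle x,d\rangle$ with $f^{g^{-1}d}\langle hx+h_0\rangle=f^d\langle x\rangle$ for all $g\in F^*$ and $(h,h_0)\in H$; it is closed under the derivation $\delta$. $\delta\text{-}\mathrm{tr.deg}\,K/C$ is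 the number of elements of a maximal system of elements of $K$ that is $\delta$-differentially algebraically independent over $C$. *)

theory Defs
  imports
    "HOL-Analysis.Cartesian_Space"
    "HOL-Library.Poly_Mapping"
    "HOL-Algebra.Group"
begin

text \<open>
  All fields live inside one ambient field of type \<^typ>\<open>'a::field\<close> with a derivation \<open>d\<close>;
  \<open>F\<close> and \<open>C\<close> are subsets of it, and the indeterminates \<open>x\<close> are elements of it that are
  differentially algebraically independent over \<open>F\<close>.
\<close>

definition derivation :: "('a::field \<Rightarrow> 'a) \<Rightarrow> bool" where
  "derivation D \<longleftrightarrow>
     (\<forall>a b. D (a + b) = D a + D b) \<and> (\<forall>a b. D (a * b) = D a * b + a * D b)"

definition differential_subfield :: "('a::field \<Rightarrow> 'a) \<Rightarrow> 'a set \<Rightarrow> bool" where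
  "differential_subfield D F \<longleftrightarrow>
     0 \<in> F \<and> 1 \<in> F \<and> (\<forall>a\<in>F. \<forall>b\<in>F. a - b \<in> F \<and> a * b \<in> F) \<and>
     (\<forall>a\<in>F. inverse a \<in> F) \<and> (\<forall>a\<in>F. D a \<in> F)"

definition constants :: "('a::field \<Rightarrow> 'a) \<Rightarrow> 'a set \<Rightarrow> 'a set" where
  "constants D F = {c \<in> F. D c = 0}"

definition scale_der :: "'a::field \<Rightarrow> ('a \<Rightarrow> 'a) \<Rightarrow> 'a \<Rightarrow> 'a" where
  "scale_der g D = (\<lambda>a. inverse g * D a)"


text \<open>
  Differential polynomials: the variable \<open>(i, k)\<close> stands for the \<open>k\<close>-th derivative of the
  \<open>i\<close>-th indeterminate. They are formal objects with no derivation attached, so that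
  \<open>dpoly_eval D u P\<close> is the value of \<open>P\<close> with both the indeterminates and the derivation
  substituted.
\<close>

type_synonym ('v, 'a) dpoly = "('v \<times> nat \<Rightarrow>\<^sub>0 nat) \<Rightarrow>\<^sub>0 'a"

definition dpolys :: "'a::zero set \<Rightarrow> 'v set \<Rightarrow> ('v, 'a) dpoly set" where
  "dpolys R I = {P. (\<forall>m\<in>Poly_Mapping.keys P.
      Poly_Mapping.lookup P m \<in> R \<and> Poly_Mapping.keys m \<subseteq> I \<times> UNIV)}"

definition dpoly_eval :: "('a::field \<Rightarrow> 'a) \<Rightarrow> ('v \<Rightarrow> 'a) \<Rightarrow> ('v, 'a) dpoly \<Rightarrow> 'a" where
  "dpoly_eval D u P =
     (\<Sum>m\<in>Poly_Mapping.keys P. Poly_Mapping.lookup P m *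
        (\<Prod>v\<in>Poly_Mapping.keys m. (D ^^ snd v) (u (fst v)) ^ Poly_Mapping.lookup m v))"

definition diff_alg_independent ::
    "('a::field \<Rightarrow> 'a) \<Rightarrow> 'a set \<Rightarrow> ('v \<Rightarrow> 'a) \<Rightarrow> 'v set \<Rightarrow> bool" where
  "diff_alg_independent D R u I \<longleftrightarrow> (\<forall>P \<in> dpolys R I. dpoly_eval D u P = 0 \<longrightarrow> P = 0)"

definition diff_rat_functions :: "('a::field \<Rightarrow> 'a) \<Rightarrow> 'a set \<Rightarrow> 'a^'n \<Rightarrow> 'a set" where
  "diff_rat_functions D R x =
     {dpoly_eval D (($) x) P / dpoly_eval D (($) x) Q | P Q.
        P \<in> dpolys R UNIV \<and> Q \<in> dpolys R UNIV \<and> dpoly_eval D (($) x) Q \<noteq> 0}"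

text \<open>
  The element obtained from the differential rational function \<open>f\<close> in \<open>x\<close> over \<open>R\<close> by replacing
  \<open>x\<close> by \<open>y\<close> and the derivation \<open>D\<close> by \<open>E\<close>. The description is proper, that is independent of the
  fraction representing \<open>f\<close>, whenever \<open>x\<close> is differentially independent over \<open>R\<close> with
  respect to \<open>D\<close>, and so is \<open>y\<close> with respect to \<open>E\<close>. This covers \<open>E = g\<^sup>-\<^sup>1 D\<close> and \<open>y = h x + h\<^sub>0\<close>.
\<close>

definition diff_subst ::
    "('a::field \<Rightarrow> 'a) \<Rightarrow> 'a set \<Rightarrow> 'a^'n \<Rightarrow> ('a \<Rightarrow> 'a) \<Rightarrow> 'a^'n \<Rightarrow> 'a \<Rightarrow> 'a" where
  "diff_subst D R x E y f =
     (THE r. \<exists>P Q. P \<in> dpolys R UNIV \<and> Q \<in> dpolys R UNIV \<and> dpoly_eval D (($) x) Q \<noteq> 0 \<and>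
        f = dpoly_eval D (($) x) P / dpoly_eval D (($) x) Q \<and>
        r = dpoly_eval E (($) y) P / dpoly_eval E (($) y) Q)"


definition matrices_over :: "'a set \<Rightarrow> ('a^'n^'n) set" where
  "matrices_over R = {h. \<forall>i j. h $ i $ j \<in> R}"

definition GL :: "'a::field set \<Rightarrow> ('a^'n^'n) set" where
  "GL R = {h \<in> matrices_over R. \<exists>k \<in> matrices_over R. h ** k = mat 1 \<and> k ** h = mat 1}"

text \<open>The pair \<open>(h, h\<^sub>0)\<close> acts by \<open>x \<mapsto> h x + h\<^sub>0\<close>; multiplication is composition of these maps.\<close>

definition affine_group :: "'a::field set \<Rightarrow> (('a^'n^'n) \<times> ('a^'n)) monoid" where
  "affine_group R =
     \<lparr>carrier = {(h, h0). h \<in> GL R \<and> (\<forall>i. h0 $ i \<in> R)},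
      monoid.mult = (\<lambda>(h, h0) (k, k0). (h ** k, h *v k0 + h0)),
      one = (mat 1, 0)\<rparr>"

definition diff_invariants ::
    "('a::field \<Rightarrow> 'a) \<Rightarrow> 'a set \<Rightarrow> (('a^'n^'n) \<times> ('a^'n)) set \<Rightarrow> 'a^'n \<Rightarrow> 'a set" where
  "diff_invariants d F H x =
     {f \<in> diff_rat_functions d (constants d F) x.
        \<forall>g \<in> F - {0}. \<forall>(h, h0) \<in> H.
          diff_subst d (constants d F) x (scale_der g d) (h *v x + h0) f = f}"


definition maximal_diff_alg_independent ::
    "('a::field \<Rightarrow> 'a) \<Rightarrow> 'a set \<Rightarrow> 'a set \<Rightarrow> 'a set \<Rightarrow> bool" where
  "maximal_diff_alg_independent D K R S \<longleftrightarrow>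
     S \<subseteq> K \<and> diff_alg_independent D R id S \<and>
     (\<forall>T. S \<subseteq> T \<and> T \<subseteq> K \<and> diff_alg_independent D R id T \<longrightarrow> T = S)"

text \<open>
  The differential transcendence degree of \<open>K\<close> over \<open>R\<close> exists and equals \<open>m\<close>: maximal
  independent systems exist, and the number of elements of each of them is \<open>m\<close>.
\<close>

definition has_diff_trdeg :: "('a::field \<Rightarrow> 'a) \<Rightarrow> 'a set \<Rightarrow> 'a set \<Rightarrow> nat \<Rightarrow> bool" where
  "has_diff_trdeg D K R m \<longleftrightarrow>
     (\<exists>S. maximal_diff_alg_independent D K R S) \<and>
     (\<forall>S. maximal_diff_alg_independent D K R S \<longrightarrow> finite S \<and> card S = m)"

end

(*
  Upper bound.  For u in F* and w = u p one has u d = w delta, so the value at u d of a differential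
  polynomial in x is a polynomial in the delta-jet of w, with coefficients in C{x, delta}.  The jets
  of u p, u in F*, are Zariski dense because F contains a t with d t nonzero; hence the identities
  expressing invariance hold for formal jets of w.  It follows that the invariants are algebraic over
  C<x, delta>, and at w = 1 the relative invariance of p = P / Q becomes the relation P = Q in x and
  delta.  So x has delta-transcendence degree at most n - 1.

  Lower bound.  The coefficients of the linear delta-equation of least order satisfied by delta x are
  unique, hence invariant.  Therefore x is delta-algebraic over the invariants, and since d = p delta,
  the growth of the d-jets of x is bounded by that of the delta-jets of m independent
  invariants and of p.  This gives n <= m + 1.

  Algebraic dependence is expressed by derivations of the ambient field: b is algebraic over k(A) iff
  every derivation vanishing on k and A kills b.  This makes closure under a further derivation a
  statement about commutators, and ranks a matter of linear algebra.
*)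
theory Submission
  imports Defs "HOL-Computational_Algebra.Polynomial"
begin

section \<open>Subrings and homogeneous linear systems\<close>

text \<open>No transcendence basis is ever chosen. The jets of order below \<open>m\<close> of an
  independent family are a fixed multiple of \<open>m\<close> independent elements, so two bounds
  linear in \<open>m\<close> are compared by their slopes, and additive constants may be crude. Two
  facts link derivations with polynomials: a relation of least degree, once differentiated, is a
  nontrivial linear relation between the values of every derivation; conversely, a family without
  relations has partial derivatives, which must be extended to the whole ambient field. In the upper
  bound the obstacle is that the factor \<open>p\<close> is fixed and \<open>u\<close> runs through
  \<open>F\<close> only; the jets of \<open>t ^ i * p\<close> still span every finite jet space, and
  natural numbers serve as coefficients, being constants in infinite supply. In the lower bound it
  is that the substitutions involve \<open>g\<close> and map \<open>L\<close> into the ambient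
  field, not into \<open>L\<close>; minimality over \<open>L\<close> can be applied to a difference
  of coefficients only after a solution of a linear system has been brought down to
  \<open>L\<close>.\<close>

definition is_subring :: "'a::field set \<Rightarrow> bool" where
  "is_subring R \<longleftrightarrow> 0 \<in> R \<and> 1 \<in> R \<and> (\<forall>a\<in>R. \<forall>b\<in>R. a - b \<in> R \<and> a * b \<in> R)"

definition is_subfield :: "'a::field set \<Rightarrow> bool" where
  "is_subfield R \<longleftrightarrow> is_subring R \<and> (\<forall>a\<in>R. inverse a \<in> R)"

context
  fixes R :: "'a::field set"
  assumes R: "is_subring R"
begin

lemma subring_zero: "0 \<in> R" and subring_one: "1 \<in> R"
  and subring_diff: "a \<in> R \<Longrightarrow> b \<in> R \<Longrightarrow> a - b \<in> R"
  and subring_mult: "a \<in> R \<Longrightarrow> b \<in> R \<Longrightarrow> a * b \<in> R"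
  using R unfolding is_subring_def by auto

lemma subring_uminus: "a \<in> R \<Longrightarrow> - a \<in> R"
  using subring_diff[OF subring_zero, of a] by simp

lemma subring_add: "a \<in> R \<Longrightarrow> b \<in> R \<Longrightarrow> a + b \<in> R"
  using subring_diff[of a "- b"] subring_uminus[of b] by simp

lemma subring_sum: "(\<And>i. i \<in> I \<Longrightarrow> f i \<in> R) \<Longrightarrow> (\<Sum>i\<in>I. f i) \<in> R"
  by (induction I rule: infinite_finite_induct) (auto simp: subring_zero subring_add)

lemma subring_power: "a \<in> R \<Longrightarrow> a ^ m \<in> R"
  by (induction m) (auto simp: subring_one subring_mult)

lemma subring_of_nat: "of_nat m \<in> R"
  by (induction m) (auto simp: subring_zero subring_one subring_add)

end

lemma subfield_divide:
  assumes "is_subfield L" "a \<in> L" "b \<in> L"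
  shows "a / b \<in> L"
  using assms by (simp add: divide_inverse is_subfield_def subring_mult)

text \<open>Gaussian elimination never leaves \<open>L\<close>. The last hypothesis offers two
  reasons for solvability: too few equations, or a nonzero solution somewhere in the ambient field.
  Both survive the elimination of one unknown, so a single induction serves for counting and for
  descent to \<open>L\<close>.\<close>

lemma homogeneous_system:
  fixes a :: "'e \<Rightarrow> 'u \<Rightarrow> 'a::field"
  assumes L: "is_subfield L" and "finite E" "finite U"
    and "\<And>e u. e \<in> E \<Longrightarrow> u \<in> U \<Longrightarrow> a e u \<in> L"
    and "card E < card U \<or> (\<exists>s. (\<exists>u\<in>U. s u \<noteq> 0) \<and> (\<forall>e\<in>E. (\<Sum>u\<in>U. a e u * s u) = 0))"
  shows "\<exists>s. (\<forall>u\<in>U. s u \<in> L) \<and> (\<exists>u\<in>U. s u \<noteq> 0) \<and> (\<forall>e\<in>E. (\<Sum>u\<in>U. a e u * s u) = 0)"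
  using assms(2-)
proof (induction E arbitrary: a U rule: finite_induct)
  case empty
  then have "U \<noteq> {}" by auto
  then obtain u where "u \<in> U" by blast
  moreover have "(1::'a) \<in> L" using L subring_one is_subfield_def by blast
  ultimately show ?case by (intro exI[of _ "\<lambda>_. 1"]) auto
next
  case (insert e E)
  have sub: "is_subring L" using L is_subfield_def by blast
  show ?case
  proof (cases "\<forall>u\<in>U. a e u = 0")
    case True
    have "card E < card U \<or> (\<exists>s. (\<exists>u\<in>U. s u \<noteq> 0) \<and> (\<forall>e\<in>E. (\<Sum>u\<in>U. a e u * s u) = 0))"
      using insert.prems(3) insert.hyps by auto
    from insert.IH[OF insert.prems(1) _ this] insert.prems(2)
    obtain s where "\<forall>u\<in>U. s u \<in> L" "\<exists>u\<in>U. s u \<noteq> 0" "\<forall>e\<in>E. (\<Sum>u\<in>U. a e u * s u) = 0" by auto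
    then show ?thesis using True by (intro exI[of _ s]) auto
  next
    case False
    then obtain u0 where u0: "u0 \<in> U" "a e u0 \<noteq> 0" by blast
    define V where "V = U - {u0}"
    have U: "U = insert u0 V" "u0 \<notin> V" "finite V" using u0 insert.prems(1) by (auto simp: V_def)
    \<comment> \<open>The pivot \<open>a e u0\<close> clears the column of \<open>u0\<close>;
      \<open>b\<close> is the system left for the other unknowns.\<close>
    define b where "b f u = a f u - a f u0 / a e u0 * a e u" for f u
    have bL: "b f u \<in> L" if "f \<in> E" "u \<in> V" for f u
      unfolding b_def using that u0 U insert.prems(2)
      by (intro subring_diff[OF sub] subring_mult[OF sub] subfield_divide[OF L]) auto
    have eq: "(\<Sum>u\<in>V. b f u * s u) = (\<Sum>u\<in>U. a f u * s u) - a f u0 / a e u0 * (\<Sum>u\<in>U. a e u * s u)"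
      for f s
      using U u0 by (simp add: b_def sum_subtractf sum_distrib_left algebra_simps)
    have "card E < card V \<or> (\<exists>s. (\<exists>u\<in>V. s u \<noteq> 0) \<and> (\<forall>e\<in>E. (\<Sum>u\<in>V. b e u * s u) = 0))"
      using insert.prems(3)
    proof
      assume "card (insert e E) < card U"
      then show ?thesis using U insert.hyps by auto
    next
      assume "\<exists>s. (\<exists>u\<in>U. s u \<noteq> 0) \<and> (\<forall>e\<in>insert e E. (\<Sum>u\<in>U. a e u * s u) = 0)"
      then obtain s where s: "\<exists>u\<in>U. s u \<noteq> 0" "\<forall>e\<in>insert e E. (\<Sum>u\<in>U. a e u * s u) = 0" by blast
      \<comment> \<open>Otherwise equation \<open>e\<close> would reduce to
        \<open>a e u0 * s u0 = 0\<close>, and the whole solution would vanish.\<close>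
      have "\<exists>u\<in>V. s u \<noteq> 0"
      proof (rule ccontr)
        assume "\<not> ?thesis"
        then have z: "\<forall>u\<in>V. s u = 0" by blast
        have "(\<Sum>u\<in>U. a e u * s u) = a e u0 * s u0" using U z by simp
        then have "s u0 = 0" using s u0 by auto
        then show False using s(1) z U by auto
      qed
      moreover have "\<forall>f\<in>E. (\<Sum>u\<in>V. b f u * s u) = 0" using s by (simp add: eq)
      ultimately show ?thesis by blast
    qed
    from insert.IH[OF \<open>finite V\<close> bL this]
    obtain s where s: "\<forall>u\<in>V. s u \<in> L" "\<exists>u\<in>V. s u \<noteq> 0" "\<forall>f\<in>E. (\<Sum>u\<in>V. b f u * s u) = 0" by auto
    define s' where "s' = s(u0 := - (\<Sum>u\<in>V. a e u * s u) / a e u0)"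
    have s'V: "s' u = s u" if "u \<in> V" for u using that U by (auto simp: s'_def)
    have e0: "(\<Sum>u\<in>U. a e u * s' u) = 0"
    proof -
      have "(\<Sum>u\<in>V. a e u * s' u) = (\<Sum>u\<in>V. a e u * s u)" using s'V by (intro sum.cong) auto
      then show ?thesis using U u0 by (simp add: s'_def)
    qed
    have f0: "(\<Sum>u\<in>U. a f u * s' u) = 0" if "f \<in> E" for f
    proof -
      have "(\<Sum>u\<in>V. b f u * s' u) = (\<Sum>u\<in>V. b f u * s u)" using s'V by (intro sum.cong) auto
      then show ?thesis using eq[of f s'] e0 s(3) that by simp
    qed
    have "s' u0 \<in> L"
      using s(1) U u0 insert.prems(2)
      by (auto simp: s'_def intro!: subfield_divide[OF L] subring_uminus[OF sub] subring_sum[OF sub] subring_mult[OF sub])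
    then have "\<forall>u\<in>U. s' u \<in> L" using s(1) s'V U by auto
    moreover have "\<exists>u\<in>U. s' u \<noteq> 0" using s(2) s'V U by auto
    ultimately show ?thesis using e0 f0 by (intro exI[of _ s']) auto
  qed
qed

section \<open>Derivations and the closure they define\<close>

lemma derivation_add: "derivation D \<Longrightarrow> D (a + b) = D a + D b"
  and derivation_mult: "derivation D \<Longrightarrow> D (a * b) = D a * b + a * D b"
  by (simp_all add: derivation_def)

lemma derivation_zero [simp]: "derivation D \<Longrightarrow> D 0 = 0"
  by (metis add_cancel_right_right derivation_add)

lemma derivation_one [simp]: "derivation D \<Longrightarrow> D 1 = 0"
  by (metis add_cancel_right_right derivation_mult mult_1 mult_1_right)

lemma derivation_uminus: "derivation D \<Longrightarrow> D (- a) = - D a"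
  using derivation_add[of D a "- a"] by (simp add: eq_neg_iff_add_eq_0 add.commute)

lemma derivation_diff: "derivation D \<Longrightarrow> D (a - b) = D a - D b"
  using derivation_add[of D a "- b"] by (simp add: derivation_uminus)

lemma derivation_sum: "derivation D \<Longrightarrow> D (\<Sum>i\<in>I. f i) = (\<Sum>i\<in>I. D (f i))"
  by (induction I rule: infinite_finite_induct) (auto simp: derivation_add)

lemma derivation_of_nat [simp]: "derivation D \<Longrightarrow> D (of_nat m) = 0"
  by (induction m) (auto simp: derivation_add)

lemma derivation_inverse:
  assumes "derivation D" "a \<noteq> 0"
  shows "D (inverse a) = - D a * inverse a * inverse a"
proof -
  have "0 = D (a * inverse a)" using assms by simp
  also have "\<dots> = D a * inverse a + a * D (inverse a)" by (rule derivation_mult[OF assms(1)])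
  finally have "a * D (inverse a) = - D a * inverse a" by (simp add: eq_neg_iff_add_eq_0 add.commute)
  moreover have "D (inverse a) = inverse a * (a * D (inverse a))"
    using assms(2) by (simp flip: mult.assoc)
  ultimately show ?thesis by simp
qed

lemma derivation_power: "derivation D \<Longrightarrow> D (a ^ m) = of_nat m * a ^ (m - 1) * D a"
proof (induction m)
  case (Suc m)
  then show ?case by (cases m) (simp_all add: derivation_mult algebra_simps)
qed simp

lemma derivation_prod:
  assumes "derivation D" "finite I"
  shows "D (\<Prod>i\<in>I. f i) = (\<Sum>i\<in>I. D (f i) * (\<Prod>j\<in>I - {i}. f j))"
  using assms(2)
proof (induction I rule: finite_induct)
  case (insert i I)
  have "(\<Prod>j\<in>insert i I - {k}. f j) = f i * (\<Prod>j\<in>I - {k}. f j)" if "k \<in> I" for k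
  proof -
    have "insert i I - {k} = insert i (I - {k})" using that insert by auto
    then show ?thesis using insert by simp
  qed
  then have "(\<Sum>k\<in>I. D (f k) * (\<Prod>j\<in>insert i I - {k}. f j)) = f i * D (\<Prod>j\<in>I. f j)"
    unfolding insert.IH sum_distrib_left by (intro sum.cong) (auto simp: algebra_simps)
  moreover have "insert i I - {i} = I" using insert by auto
  ultimately show ?case using insert by (simp add: derivation_mult[OF assms(1)])
qed (simp add: assms)

lemma derivation_scale: "derivation D \<Longrightarrow> derivation (\<lambda>a. c * D a)"
  by (auto simp: derivation_def algebra_simps)

lemma derivation_scale_der: "derivation D \<Longrightarrow> derivation (scale_der g D)"
  unfolding scale_der_def by (rule derivation_scale)

lemma derivation_commutator:
  "derivation D \<Longrightarrow> derivation E \<Longrightarrow> derivation (\<lambda>a. D (E a) - E (D a))"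
  unfolding derivation_def by (auto simp: algebra_simps)

lemma derivation_lin_comb:
  assumes "\<And>i. i \<in> I \<Longrightarrow> derivation (D i)"
  shows "derivation (\<lambda>a. \<Sum>i\<in>I. c i * D i a)"
  using assms unfolding derivation_def
  by (simp add: algebra_simps sum.distrib sum_distrib_left)

lemma derivation_iter_add: "derivation D \<Longrightarrow> (D ^^ k) (a + b) = (D ^^ k) a + (D ^^ k) b"
  by (induction k) (auto simp: derivation_add)

lemma derivation_iter_sum: "derivation D \<Longrightarrow> (D ^^ k) (\<Sum>i\<in>I. f i) = (\<Sum>i\<in>I. (D ^^ k) (f i))"
  by (induction k) (auto simp: derivation_sum)

lemma derivation_iter_const_mult:
  "derivation D \<Longrightarrow> D c = 0 \<Longrightarrow> (D ^^ k) (c * a) = c * (D ^^ k) a"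
  by (induction k) (auto simp: derivation_mult)

text \<open>In characteristic zero this is the relative algebraic closure of the field generated by
  \<open>k\<close> and \<open>A\<close>.\<close>

definition der_closure :: "'a::field set \<Rightarrow> 'a set \<Rightarrow> 'a set" where
  "der_closure k A = {b. \<forall>D. derivation D \<longrightarrow> (\<forall>a\<in>k \<union> A. D a = 0) \<longrightarrow> D b = 0}"

lemma der_closureI:
  "(\<And>D. derivation D \<Longrightarrow> (\<And>a. a \<in> k \<Longrightarrow> D a = 0) \<Longrightarrow> (\<And>a. a \<in> A \<Longrightarrow> D a = 0) \<Longrightarrow> D b = 0)
    \<Longrightarrow> b \<in> der_closure k A"
  unfolding der_closure_def by blast

lemma der_closureD:
  "b \<in> der_closure k A \<Longrightarrow> derivation D \<Longrightarrow> (\<And>a. a \<in> k \<Longrightarrow> D a = 0) \<Longrightarrow> (\<And>a. a \<in> A \<Longrightarrow> D a = 0)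
    \<Longrightarrow> D b = 0"
  unfolding der_closure_def by blast

lemma der_closure_base: "k \<subseteq> der_closure k A"
  unfolding der_closure_def by blast

lemma der_closure_incl: "A \<subseteq> der_closure k A"
  unfolding der_closure_def by blast

lemma der_closure_trans: "A \<subseteq> der_closure k B \<Longrightarrow> b \<in> der_closure k A \<Longrightarrow> b \<in> der_closure k B"
  unfolding der_closure_def by blast

lemma der_closure_mono: "A \<subseteq> B \<Longrightarrow> der_closure k A \<subseteq> der_closure k B"
  unfolding der_closure_def by blast

lemma is_subfield_der_closure: "is_subfield (der_closure k A)"
proof -
  have "D (inverse a) = 0" if "derivation D" "D a = 0" for D and a :: 'a
    using that by (cases "a = 0") (auto simp: derivation_inverse)
  then show ?thesis
    unfolding is_subfield_def is_subring_def der_closure_def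
    by (auto simp: derivation_diff derivation_mult)
qed

lemma is_subring_der_closure: "is_subring (der_closure k A)"
  using is_subfield_der_closure is_subfield_def by blast

text \<open>\<open>D\<close> need not commute with \<open>E\<close>, but their commutator is again a
  derivation. It kills \<open>k\<close> and \<open>A\<close> as soon as \<open>D\<close> kills
  \<open>k\<close>, \<open>A\<close> and the image of \<open>A\<close> under \<open>E\<close>, hence
  it kills \<open>b\<close>.\<close>

lemma der_closure_derivation:
  assumes E: "derivation E" and Ek: "\<And>c. c \<in> k \<Longrightarrow> E c \<in> k" and b: "b \<in> der_closure k A"
  shows "E b \<in> der_closure k (A \<union> E ` A)"
proof (rule der_closureI)
  fix D assume D: "derivation D" "\<And>a. a \<in> k \<Longrightarrow> D a = 0" "\<And>a. a \<in> A \<union> E ` A \<Longrightarrow> D a = 0"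
  have "D (E b) - E (D b) = 0"
    using der_closureD[OF b derivation_commutator[OF D(1) E]] D E Ek by auto
  moreover have "D b = 0" using der_closureD[OF b D(1)] D by auto
  ultimately show "D (E b) = 0" using E by simp
qed

text \<open>A family and not a set, so that a repeated value counts as a dependence.\<close>

definition der_independent :: "'a::field set \<Rightarrow> ('i \<Rightarrow> 'a) \<Rightarrow> 'i set \<Rightarrow> bool" where
  "der_independent k v I \<longleftrightarrow> (\<forall>i\<in>I. v i \<notin> der_closure k (v ` (I - {i})))"

text \<open>Independence supplies derivations \<open>D i\<close> dual to the family up to nonzero
  factors. If \<open>A\<close> were smaller than \<open>I\<close>, linear algebra would give a
  nontrivial combination of the \<open>D i\<close> that kills \<open>A\<close>, hence every
  \<open>v i\<close>; but at \<open>v i\<close> it takes the value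
  \<open>s i * D i (v i)\<close>.\<close>

lemma der_independent_card_le:
  assumes v: "der_independent k v I" and "finite I" "finite A" and vA: "v ` I \<subseteq> der_closure k A"
  shows "card I \<le> card A"
proof (rule ccontr)
  assume less: "\<not> card I \<le> card A"
  have "\<forall>i\<in>I. \<exists>D. derivation D \<and> (\<forall>a\<in>k. D a = 0) \<and> (\<forall>j\<in>I - {i}. D (v j) = 0) \<and> D (v i) \<noteq> 0"
  proof
    fix i assume "i \<in> I"
    then have "v i \<notin> der_closure k (v ` (I - {i}))" using v by (simp add: der_independent_def)
    then obtain D where "derivation D" "\<forall>a\<in>k \<union> v ` (I - {i}). D a = 0" "D (v i) \<noteq> 0"
      unfolding der_closure_def by blast
    then show "\<exists>D. derivation D \<and> (\<forall>a\<in>k. D a = 0) \<and> (\<forall>j\<in>I - {i}. D (v j) = 0) \<and> D (v i) \<noteq> 0"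
      by (intro exI[of _ D]) simp
  qed
  from bchoice[OF this] obtain D where
    D: "\<And>i. i \<in> I \<Longrightarrow> derivation (D i)" "\<And>i a. i \<in> I \<Longrightarrow> a \<in> k \<Longrightarrow> D i a = 0"
    "\<And>i j. i \<in> I \<Longrightarrow> j \<in> I \<Longrightarrow> j \<noteq> i \<Longrightarrow> D i (v j) = 0" "\<And>i. i \<in> I \<Longrightarrow> D i (v i) \<noteq> 0"
    by blast
  have U: "is_subfield (UNIV :: 'a set)" by (auto simp: is_subfield_def is_subring_def)
  obtain s where s: "\<exists>i\<in>I. s i \<noteq> 0" "\<forall>a\<in>A. (\<Sum>i\<in>I. D i a * s i) = 0"
    using homogeneous_system[OF U \<open>finite A\<close> \<open>finite I\<close>, of "\<lambda>a i. D i a"] less by auto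
  define E where "E = (\<lambda>a. \<Sum>i\<in>I. s i * D i a)"
  have "derivation E" unfolding E_def by (rule derivation_lin_comb) (rule D)
  moreover have "E a = 0" if "a \<in> k" for a using D that by (simp add: E_def)
  moreover have "E a = 0" if "a \<in> A" for a using s that by (simp add: E_def mult.commute)
  ultimately have E0: "E (v i) = 0" if "i \<in> I" for i
    using vA that der_closureD[of "v i" k A E] by blast
  have "s i = 0" if "i \<in> I" for i
  proof -
    have "E (v i) = (\<Sum>j\<in>I. if j = i then s i * D i (v i) else 0)"
      unfolding E_def using D that by (intro sum.cong) auto
    also have "\<dots> = s i * D i (v i)" using that \<open>finite I\<close> by simp
    finally show ?thesis using E0[OF that] D(4)[OF that] by simp
  qed
  then show False using s by blast
qed

section \<open>Extension of derivations\<close>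

text \<open>The graph of a derivation defined on a subring, viewed as a subring of the dual numbers.\<close>

definition der_graph :: "('a::field \<times> 'a) set \<Rightarrow> bool" where
  "der_graph G \<longleftrightarrow> (1, 0) \<in> G \<and> (\<forall>b. (0, b) \<in> G \<longrightarrow> b = 0) \<and>
     (\<forall>a a' b b'. (a, a') \<in> G \<longrightarrow> (b, b') \<in> G \<longrightarrow> (a - b, a' - b') \<in> G \<and> (a * b, a' * b + a * b') \<in> G)"

context
  fixes G :: "('a::field_char_0 \<times> 'a) set"
  assumes G: "der_graph G"
begin

lemma der_graph_one: "(1, 0) \<in> G" and der_graph_zeroD: "(0, b) \<in> G \<Longrightarrow> b = 0"
  and der_graph_diff: "(a, a') \<in> G \<Longrightarrow> (b, b') \<in> G \<Longrightarrow> (a - b, a' - b') \<in> G"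
  and der_graph_mult: "(a, a') \<in> G \<Longrightarrow> (b, b') \<in> G \<Longrightarrow> (a * b, a' * b + a * b') \<in> G"
  using G unfolding der_graph_def by blast+

lemma der_graph_zero: "(0, 0) \<in> G"
  using der_graph_diff[OF der_graph_one der_graph_one] by simp

lemma der_graph_add:
  assumes "(a, a') \<in> G" "(b, b') \<in> G"
  shows "(a + b, a' + b') \<in> G"
  using der_graph_diff[OF assms(1) der_graph_diff[OF der_graph_zero assms(2)]] by simp

lemma der_graph_sum:
  "(\<And>i. i \<in> I \<Longrightarrow> (f i, g i) \<in> G) \<Longrightarrow> ((\<Sum>i\<in>I. f i), (\<Sum>i\<in>I. g i)) \<in> G"
  by (induction I rule: infinite_finite_induct) (simp_all add: der_graph_zero der_graph_add)

lemma der_graph_of_nat: "(of_nat m, 0) \<in> G"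
proof (induction m)
  case (Suc m)
  show ?case using der_graph_add[OF der_graph_one Suc.IH] by simp
qed (simp add: der_graph_zero)

text \<open>The second component is the first with the derivation applied to the coefficients, the
  variable being treated as a constant.\<close>

definition poly_graph :: "('a poly \<times> 'a poly) set" where
  "poly_graph = {(f, g). \<forall>i. (coeff f i, coeff g i) \<in> G}"

lemma poly_graph_diff:
  "(f, f') \<in> poly_graph \<Longrightarrow> (g, g') \<in> poly_graph \<Longrightarrow> (f - g, f' - g') \<in> poly_graph"
  by (simp add: poly_graph_def der_graph_diff)

lemma poly_graph_mult:
  assumes "(f, f') \<in> poly_graph" "(g, g') \<in> poly_graph"
  shows "(f * g, f' * g + f * g') \<in> poly_graph"
proof -
  have "((\<Sum>j\<le>i. coeff f j * coeff g (i - j)),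
      (\<Sum>j\<le>i. coeff f' j * coeff g (i - j) + coeff f j * coeff g' (i - j))) \<in> G" for i
    using assms by (intro der_graph_sum der_graph_mult) (auto simp: poly_graph_def)
  then show ?thesis by (simp add: poly_graph_def coeff_mult sum.distrib)
qed

lemma poly_graph_const: "(a, a') \<in> G \<Longrightarrow> ([:a:], [:a':]) \<in> poly_graph"
  by (auto simp: poly_graph_def coeff_pCons der_graph_zero split: nat.split)

lemma poly_graph_monom: "(a, a') \<in> G \<Longrightarrow> (monom a m, monom a' m) \<in> poly_graph"
  by (auto simp: poly_graph_def der_graph_zero)

lemma poly_graph_pderiv:
  assumes "(f, f') \<in> poly_graph"
  shows "(pderiv f, pderiv f') \<in> poly_graph"
proof -
  have "(of_nat (Suc i) * coeff f (Suc i), 0 * coeff f (Suc i) + of_nat (Suc i) * coeff f' (Suc i)) \<in> G" for i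
    using assms by (intro der_graph_mult der_graph_of_nat) (auto simp: poly_graph_def)
  then show ?thesis by (simp add: poly_graph_def coeff_pderiv)
qed

text \<open>By the chain rule, the value that a derivation must take at \<open>poly f c\<close> once
  it takes \<open>c\<close> to \<open>e\<close>.\<close>

definition adjoin_der :: "'a \<Rightarrow> 'a \<Rightarrow> 'a poly \<times> 'a poly \<Rightarrow> 'a" where
  "adjoin_der c e = (\<lambda>(f, g). poly g c + poly (pderiv f) c * e)"

text \<open>If \<open>c\<close> is transcendental over the domain of \<open>G\<close>, any
  \<open>e\<close> will do. Otherwise a polynomial \<open>q\<close> of least degree vanishing at
  \<open>c\<close> forces the choice of \<open>e\<close>: its derivative is nonzero in
  characteristic zero and, by minimality, does not vanish at \<open>c\<close>. Division by
  \<open>q\<close> carries the condition over to all other polynomials.\<close>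

lemma adjoin_der_exists: "\<exists>e. \<forall>(f, g) \<in> poly_graph. poly f c = 0 \<longrightarrow> adjoin_der c e (f, g) = 0"
proof (cases "\<exists>f g. (f, g) \<in> poly_graph \<and> f \<noteq> 0 \<and> poly f c = 0")
  case False
  have "adjoin_der c 0 (f, g) = 0" if "(f, g) \<in> poly_graph" "poly f c = 0" for f g
  proof -
    have "f = 0" using that False by blast
    then have "g = 0" using that(1) der_graph_zeroD by (auto simp: poly_graph_def poly_eq_iff)
    then show ?thesis using \<open>f = 0\<close> by (simp add: adjoin_der_def)
  qed
  then show ?thesis by (intro exI[of _ 0]) auto
next
  case True
  define Z where "Z m \<longleftrightarrow> (\<exists>f g. (f, g) \<in> poly_graph \<and> f \<noteq> 0 \<and> poly f c = 0 \<and> degree f = m)" for m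
  have "\<exists>m. Z m" using True unfolding Z_def by blast
  then have "Z (LEAST m. Z m)" by (rule LeastI_ex)
  then obtain q q' where q: "(q, q') \<in> poly_graph" "q \<noteq> 0" "poly q c = 0" "degree q = (LEAST m. Z m)"
    unfolding Z_def by blast
  have minq: "f = 0" if "(f, g) \<in> poly_graph" "poly f c = 0" "degree f < degree q" for f g
  proof (rule ccontr)
    assume "f \<noteq> 0"
    then have "Z (degree f)" using that unfolding Z_def by blast
    then show False using that(3) not_less_Least[of "degree f" Z] q(4) by simp
  qed
  have dq: "degree q > 0"
  proof (rule ccontr)
    assume "\<not> ?thesis"
    then obtain a where "q = [:a:]" by (auto elim: degree_eq_zeroE)
    then show False using q by simp
  qed
  have q'c: "poly (pderiv q) c \<noteq> 0"
  proof
    assume "poly (pderiv q) c = 0"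
    then have "pderiv q = 0" using minq[OF poly_graph_pderiv[OF q(1)]] dq by (simp add: degree_pderiv)
    then show False using dq by (simp add: pderiv_eq_0_iff)
  qed
  define e where "e = - poly q' c / poly (pderiv q) c"
  have Tq: "adjoin_der c e (q, q') = 0" using q'c by (simp add: adjoin_der_def e_def)
  have "adjoin_der c e (f, f') = 0" if "(f, f') \<in> poly_graph" "poly f c = 0" for f f'
    using that
  proof (induction "degree f" arbitrary: f f' rule: less_induct)
    case less
    show ?case
    proof (cases "f = 0")
      case True
      then have "f' = 0" using less.prems(1) der_graph_zeroD by (auto simp: poly_graph_def poly_eq_iff)
      then show ?thesis using True by (simp add: adjoin_der_def)
    next
      case False
      then have ge: "degree q \<le> degree f" using minq[OF less.prems] by (cases "degree f < degree q") auto
      define m where "m = degree f - degree q"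
      define a a' b b' where "a = lead_coeff q" "a' = coeff q' (degree q)"
        "b = lead_coeff f" "b' = coeff f' (degree f)"
      note ab = this
      have aG: "(a, a') \<in> G" and bG: "(b, b') \<in> G"
        using q(1) less.prems(1) by (auto simp: ab poly_graph_def)
      \<comment> \<open>Pseudo-division: the domain of \<open>G\<close> is only a ring, so the
        leading coefficients are multiplied crosswise. \<open>g'\<close> is what the product rule
        attaches to \<open>g\<close>.\<close>
      define g where "g = [:a:] * f - monom b m * q"
      define g' where "g' = [:a':] * f + [:a:] * f' - (monom b' m * q + monom b m * q')"
      have gG: "(g, g') \<in> poly_graph"
        unfolding g_def g'_def
        by (intro poly_graph_diff poly_graph_mult poly_graph_const poly_graph_monom aG bG q(1) less.prems(1))
      have gc: "poly g c = 0" using q less.prems by (simp add: g_def)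
      have "coeff g (degree f) = 0"
        using ge by (simp add: g_def coeff_monom_mult m_def ab)
      moreover have "degree g \<le> degree f"
      proof -
        have "degree (monom b m * q) \<le> m + degree q"
          by (rule order.trans[OF degree_mult_le]) (simp add: degree_monom_le)
        also have "\<dots> = degree f" using ge by (simp add: m_def)
        finally have "degree (monom b m * q) \<le> degree f" .
        moreover have "degree ([:a:] * f) \<le> degree f" by simp
        ultimately show ?thesis unfolding g_def by (rule degree_diff_le[rotated])
      qed
      moreover have "degree g \<noteq> degree f"
      proof
        assume eq: "degree g = degree f"
        then have "g = 0" using \<open>coeff g (degree f) = 0\<close> by (metis leading_coeff_0_iff)
        then show False using eq dq ge by simp
      qed
      ultimately have "degree g < degree f" by simp
      then have "adjoin_der c e (g, g') = 0" using less.hyps gG gc by blast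
      \<comment> \<open>The terms with \<open>a'\<close>, \<open>b'\<close> or the derivative of
        \<open>monom b m\<close> carry a factor \<open>poly f c\<close> or \<open>poly q c\<close>
        and disappear.\<close>
      moreover have "adjoin_der c e (g, g') = a * adjoin_der c e (f, f') - b * c ^ m * adjoin_der c e (q, q')"
        using q(3) less.prems(2)
        by (simp add: adjoin_der_def g_def g'_def poly_monom pderiv_diff pderiv_mult pderiv_smult algebra_simps)
      moreover have "a \<noteq> 0" using q(2) leading_coeff_0_iff[of q] unfolding ab by blast
      ultimately show ?thesis using Tq by simp
    qed
  qed
  then show ?thesis by (intro exI[of _ e]) auto
qed

text \<open>A relation closed under differences is single valued once \<open>0\<close> has only the
  value \<open>0\<close>; for the enlarged graph this is the defining property of
  \<open>e\<close>.\<close>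

lemma der_graph_adjoin: "\<exists>G'. der_graph G' \<and> G \<subseteq> G' \<and> c \<in> fst ` G'"
proof -
  obtain e where e: "\<And>f g. (f, g) \<in> poly_graph \<Longrightarrow> poly f c = 0 \<Longrightarrow> adjoin_der c e (f, g) = 0"
    using adjoin_der_exists[of c] by auto
  define G' where "G' = {(poly f c, adjoin_der c e (f, g)) | f g. (f, g) \<in> poly_graph}"
  have G'I: "(a, b) \<in> G'" if "(f, g) \<in> poly_graph" "a = poly f c" "b = adjoin_der c e (f, g)" for a b f g
    using that unfolding G'_def by blast
  have sub: "G \<subseteq> G'"
  proof
    fix y assume "y \<in> G"
    then show "y \<in> G'"
      by (cases y) (auto intro!: G'I[OF poly_graph_const] simp: adjoin_der_def)
  qed
  have c: "(c, e) \<in> G'"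
    by (rule G'I[OF poly_graph_monom[OF der_graph_one, of 1]])
       (simp_all add: adjoin_der_def poly_monom pderiv_monom)
  have "der_graph G'"
    unfolding der_graph_def
  proof (intro conjI allI impI)
    show "(1, 0) \<in> G'" using sub der_graph_one by blast
  next
    fix b assume "(0, b) \<in> G'"
    then show "b = 0" using e unfolding G'_def by auto
  next
    fix a a' b b' assume "(a, a') \<in> G'" "(b, b') \<in> G'"
    then obtain f f' g g' where
      fg: "(f, f') \<in> poly_graph" "a = poly f c" "a' = adjoin_der c e (f, f')"
          "(g, g') \<in> poly_graph" "b = poly g c" "b' = adjoin_der c e (g, g')"
      unfolding G'_def by blast
    show "(a - b, a' - b') \<in> G'"
      by (rule G'I[OF poly_graph_diff[OF fg(1) fg(4)]])
         (simp_all add: fg adjoin_der_def pderiv_diff algebra_simps)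
    show "(a * b, a' * b + a * b') \<in> G'"
      by (rule G'I[OF poly_graph_mult[OF fg(1) fg(4)]])
         (simp_all add: fg adjoin_der_def pderiv_mult algebra_simps)
  qed
  then show ?thesis using sub c by force
qed

end

text \<open>Zorn's lemma for graphs ordered by inclusion: a maximal graph has full domain, since any
  missing element could be adjoined.\<close>

lemma derivation_extension:
  fixes G0 :: "('a::field_char_0 \<times> 'a) set"
  assumes G0: "der_graph G0"
  shows "\<exists>D. derivation D \<and> (\<forall>(a, b) \<in> G0. D a = b)"
proof -
  define A where "A = {G. der_graph G \<and> G0 \<subseteq> G}"
  have "\<exists>M\<in>A. \<forall>X\<in>A. M \<subseteq> X \<longrightarrow> X = M"
  proof (rule subset_Zorn_nonempty)
    show "A \<noteq> {}" using G0 A_def by auto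
  next
    fix C assume C: "C \<noteq> {}" "subset.chain A C"
    then have CA: "\<And>G. G \<in> C \<Longrightarrow> der_graph G \<and> G0 \<subseteq> G" and
      tot: "\<And>X Y. X \<in> C \<Longrightarrow> Y \<in> C \<Longrightarrow> X \<subseteq> Y \<or> Y \<subseteq> X"
      by (auto simp: subset_chain_def A_def)
    have "der_graph (\<Union>C)"
      unfolding der_graph_def
    proof (intro conjI allI impI)
      obtain G where "G \<in> C" using C(1) by blast
      then show "(1, 0) \<in> \<Union>C" using CA der_graph_one by (metis UnionI)
    next
      fix b assume "(0, b) \<in> \<Union>C"
      then obtain G where "G \<in> C" "(0, b) \<in> G" by blast
      then show "b = 0" using CA der_graph_zeroD by metis
    next
      fix a a' b b' assume "(a, a') \<in> \<Union>C" "(b, b') \<in> \<Union>C"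
      then obtain G where G: "G \<in> C" "(a, a') \<in> G" "(b, b') \<in> G" using tot by blast
      then have "(a - b, a' - b') \<in> G" "(a * b, a' * b + a * b') \<in> G"
        using CA der_graph_diff[of G] der_graph_mult[of G] by simp_all
      then show "(a - b, a' - b') \<in> \<Union>C" "(a * b, a' * b + a * b') \<in> \<Union>C" using G(1) by auto
    qed
    moreover have "G0 \<subseteq> \<Union>C" using C(1) CA by blast
    ultimately show "\<Union>C \<in> A" by (simp add: A_def)
  qed
  then obtain M where max: "M \<in> A" "\<forall>X\<in>A. M \<subseteq> X \<longrightarrow> X = M" by blast
  then have M: "der_graph M" "G0 \<subseteq> M" by (simp_all add: A_def)
  have M_max: "X = M" if "der_graph X" "M \<subseteq> X" for X
    using max(2) that M(2) by (auto simp: A_def)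
  have dom: "\<exists>b. (a, b) \<in> M" for a
  proof -
    obtain X where "der_graph X" "M \<subseteq> X" "a \<in> fst ` X" using der_graph_adjoin[OF M(1)] by blast
    then show ?thesis using M_max by force
  qed
  have unique: "b = b'" if "(a, b) \<in> M" "(a, b') \<in> M" for a b b'
    using der_graph_zeroD[OF M(1), of "b - b'"] der_graph_diff[OF M(1) that] by simp
  obtain D where D: "\<And>a. (a, D a) \<in> M" using dom by metis
  have "derivation D"
    unfolding derivation_def
    using unique[OF D der_graph_add[OF M(1) D D]] unique[OF D der_graph_mult[OF M(1) D D]] by simp
  moreover have "\<forall>(a, b) \<in> G0. D a = b" using unique[OF D] M(2) by blast
  ultimately show ?thesis by blast
qed

section \<open>Polynomials and algebraic dependence\<close>

type_synonym ('v, 'a) mpoly = "('v \<Rightarrow>\<^sub>0 nat) \<Rightarrow>\<^sub>0 'a"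

definition mono_eval :: "('v \<Rightarrow> 'a::comm_semiring_1) \<Rightarrow> ('v \<Rightarrow>\<^sub>0 nat) \<Rightarrow> 'a" where
  "mono_eval v m = (\<Prod>i\<in>Poly_Mapping.keys m. v i ^ Poly_Mapping.lookup m i)"

definition mpoly_eval :: "('v \<Rightarrow> 'a::comm_semiring_1) \<Rightarrow> ('v, 'a) mpoly \<Rightarrow> 'a" where
  "mpoly_eval v P = (\<Sum>m\<in>Poly_Mapping.keys P. Poly_Mapping.lookup P m * mono_eval v m)"

definition mpolys :: "'a::zero set \<Rightarrow> 'v set \<Rightarrow> ('v, 'a) mpoly set" where
  "mpolys R J = {P. \<forall>m\<in>Poly_Mapping.keys P. Poly_Mapping.lookup P m \<in> R \<and> Poly_Mapping.keys m \<subseteq> J}"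

lemma mono_eval_superset:
  assumes "finite J" "Poly_Mapping.keys m \<subseteq> J"
  shows "mono_eval v m = (\<Prod>i\<in>J. v i ^ Poly_Mapping.lookup m i)"
  unfolding mono_eval_def using assms
  by (intro prod.mono_neutral_left) (auto simp: in_keys_iff)

lemma mono_eval_zero [simp]: "mono_eval v 0 = 1"
  by (simp add: mono_eval_def)

lemma mono_eval_add: "mono_eval v (m + m') = mono_eval v m * mono_eval v m'"
proof -
  define J where "J = Poly_Mapping.keys m \<union> Poly_Mapping.keys m'"
  have "finite J" "Poly_Mapping.keys m \<subseteq> J" "Poly_Mapping.keys m' \<subseteq> J"
    "Poly_Mapping.keys (m + m') \<subseteq> J"
    using Poly_Mapping.keys_add[of m m'] by (auto simp: J_def)
  then show ?thesis
    by (simp add: mono_eval_superset[of J] lookup_add power_add prod.distrib)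
qed

lemma mpoly_eval_add: "mpoly_eval v (P + Q) = mpoly_eval v P + mpoly_eval v Q"
  unfolding mpoly_eval_def by (rule setsum_keys_plus_distrib) (auto simp: algebra_simps)

lemma mpoly_eval_zero [simp]: "mpoly_eval v 0 = 0"
  by (simp add: mpoly_eval_def)

lemma mpoly_eval_single [simp]: "mpoly_eval v (Poly_Mapping.single m c) = c * mono_eval v m"
  by (cases "c = 0") (auto simp: mpoly_eval_def)

lemma mpoly_eval_const: "mpoly_eval v (Poly_Mapping.single 0 c) = c"
  by (simp add: mono_eval_def)

lemma mpoly_eval_var: "mpoly_eval v (Poly_Mapping.single (Poly_Mapping.single i 1) 1) = v i"
  by (simp add: mono_eval_def)

lemma update_eq_add_single:
  assumes "a \<notin> Poly_Mapping.keys f"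
  shows "Poly_Mapping.update a b f = f + Poly_Mapping.single a (b :: 'b::monoid_add)"
  using assms
  by (intro poly_mapping_eqI) (auto simp: lookup_update lookup_add lookup_single when_def in_keys_iff)

lemma mpolys_induct [consumes 1, case_names zero add]:
  assumes "P \<in> mpolys R J" and "Q 0"
    and "\<And>P m c. P \<in> mpolys R J \<Longrightarrow> Q P \<Longrightarrow> c \<in> R \<Longrightarrow> Poly_Mapping.keys m \<subseteq> J \<Longrightarrow>
      Q (P + Poly_Mapping.single m (c :: 'a::monoid_add))"
  shows "Q P"
  using assms(1)
proof (induction P rule: update_induct)
  case const
  then show ?case using assms(2) by simp
next
  case (update f a b)
  have keys: "Poly_Mapping.keys (Poly_Mapping.update a b f) = insert a (Poly_Mapping.keys f)"
    using update.hyps by (simp add: keys_update)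
  have "f \<in> mpolys R J"
    unfolding mpolys_def
  proof (clarify, intro conjI)
    fix m assume m: "m \<in> Poly_Mapping.keys f"
    then have "m \<noteq> a" using update.hyps by auto
    then show "Poly_Mapping.lookup f m \<in> R"
      using update.prems m keys unfolding mpolys_def by (auto simp: lookup_update split: if_splits)
    show "Poly_Mapping.keys m \<subseteq> J" using update.prems m keys unfolding mpolys_def by auto
  qed
  moreover have "b \<in> R" "Poly_Mapping.keys a \<subseteq> J"
    using update.prems keys unfolding mpolys_def by (auto simp: lookup_update)
  ultimately show ?case
    using assms(3) update.hyps update.IH by (simp add: update_eq_add_single)
qed

lemma mpolys_UNIV: "P \<in> mpolys UNIV UNIV"
  by (simp add: mpolys_def)

lemma mpoly_eval_mult:
  "mpoly_eval v (P * Q) = mpoly_eval v P * mpoly_eval v (Q :: ('v, 'a::comm_semiring_1) mpoly)"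
proof -
  have single: "mpoly_eval v (Poly_Mapping.single m c * Q) = c * mono_eval v m * mpoly_eval v Q" for m c
    using mpolys_UNIV[of Q]
    by (induction Q rule: mpolys_induct)
       (simp_all add: distrib_left mpoly_eval_add mult_single mono_eval_add mult_ac)
  show ?thesis
    using mpolys_UNIV[of P]
    by (induction P rule: mpolys_induct) (simp_all add: distrib_right mpoly_eval_add single)
qed

lemma mpoly_eval_uminus: "mpoly_eval v (- P) = - mpoly_eval v (P :: ('v, 'a::comm_ring_1) mpoly)"
  using mpoly_eval_add[of v P "- P"] by (simp add: eq_neg_iff_add_eq_0 add.commute)

lemma mpoly_eval_diff:
  "mpoly_eval v (P - Q) = mpoly_eval v P - mpoly_eval v (Q :: ('v, 'a::comm_ring_1) mpoly)"
  using mpoly_eval_add[of v P "- Q"] by (simp add: mpoly_eval_uminus)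

lemma mpolys_zero [simp]: "0 \<in> mpolys R J"
  by (simp add: mpolys_def)

lemma mpolys_single: "c \<in> R \<Longrightarrow> Poly_Mapping.keys m \<subseteq> J \<Longrightarrow> Poly_Mapping.single m c \<in> mpolys R J"
  by (simp add: mpolys_def)

lemma mpolys_var: "1 \<in> R \<Longrightarrow> i \<in> J \<Longrightarrow>
  Poly_Mapping.single (Poly_Mapping.single i 1) (1 :: 'a::zero_neq_one) \<in> mpolys R J"
  by (rule mpolys_single) auto

lemma mpolys_mono: "R \<subseteq> S \<Longrightarrow> J \<subseteq> K \<Longrightarrow> mpolys R J \<subseteq> mpolys S K"
  by (auto simp: mpolys_def)

context
  fixes R :: "'a::field set"
  assumes R: "is_subring R"
begin

lemma mpolys_iff:
  "P \<in> mpolys R J \<longleftrightarrow> (\<forall>m. Poly_Mapping.lookup P m \<in> R) \<and> (\<forall>m\<in>Poly_Mapping.keys P. Poly_Mapping.keys m \<subseteq> J)"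
  unfolding mpolys_def using subring_zero[OF R] by (auto simp: in_keys_iff)

lemma mpolys_add: "P \<in> mpolys R J \<Longrightarrow> Q \<in> mpolys R J \<Longrightarrow> P + Q \<in> mpolys R J"
  unfolding mpolys_iff using Poly_Mapping.keys_add[of P Q]
  by (fastforce simp: lookup_add subring_add[OF R])

lemma mpolys_uminus: "P \<in> mpolys R J \<Longrightarrow> - P \<in> mpolys R J"
  unfolding mpolys_iff by (simp add: subring_uminus[OF R] in_keys_iff)

lemma mpolys_diff: "P \<in> mpolys R J \<Longrightarrow> Q \<in> mpolys R J \<Longrightarrow> P - Q \<in> mpolys R J"
  using mpolys_add[of P J "- Q"] mpolys_uminus[of Q] by simp

lemma mpolys_sum: "(\<And>i. i \<in> I \<Longrightarrow> f i \<in> mpolys R J) \<Longrightarrow> (\<Sum>i\<in>I. f i) \<in> mpolys R J"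
  by (induction I rule: infinite_finite_induct) (simp_all add: mpolys_add)

lemma mpolys_mult:
  assumes "P \<in> mpolys R J" "Q \<in> mpolys R J"
  shows "P * Q \<in> mpolys R J"
proof -
  have single: "Poly_Mapping.single m c * Q \<in> mpolys R J"
    if "c \<in> R" "Poly_Mapping.keys m \<subseteq> J" for m c
    using assms(2)
  proof (induction Q rule: mpolys_induct)
    case (add Q m' c')
    have "Poly_Mapping.keys (m + m') \<subseteq> J"
      using Poly_Mapping.keys_add[of m m'] that add by blast
    then show ?case
      using add that by (simp add: distrib_left mult_single mpolys_add mpolys_single subring_mult[OF R])
  qed simp
  show ?thesis
    using assms(1)
    by (induction P rule: mpolys_induct) (simp_all add: distrib_right mpolys_add single)
qed

end

text \<open>The truncated subtraction of exponents is harmless: a monomial without the variable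
  \<open>i\<close> gets the coefficient \<open>0\<close>.\<close>

definition partial_der :: "'v \<Rightarrow> ('v, 'a::comm_semiring_1) mpoly \<Rightarrow> ('v, 'a) mpoly" where
  "partial_der i P = (\<Sum>m\<in>Poly_Mapping.keys P.
     Poly_Mapping.single (m - Poly_Mapping.single i 1) (Poly_Mapping.lookup P m * of_nat (Poly_Mapping.lookup m i)))"

lemma partial_der_zero [simp]: "partial_der i 0 = 0"
  by (simp add: partial_der_def)

lemma partial_der_add: "partial_der i (P + Q) = partial_der i P + partial_der i Q"
  unfolding partial_der_def by (rule setsum_keys_plus_distrib) (auto simp: algebra_simps single_add)

lemma partial_der_single [simp]: "partial_der i (Poly_Mapping.single m c) =
    Poly_Mapping.single (m - Poly_Mapping.single i 1) (c * of_nat (Poly_Mapping.lookup m i))"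
  by (cases "c = 0") (auto simp: partial_der_def)

lemma partial_der_uminus: "partial_der i (- P) = - partial_der i (P :: ('v, 'a::comm_ring_1) mpoly)"
  using partial_der_add[of i P "- P"] by (simp add: eq_neg_iff_add_eq_0 add.commute)

lemma partial_der_diff:
  "partial_der i (P - Q) = partial_der i P - partial_der i (Q :: ('v, 'a::comm_ring_1) mpoly)"
  using partial_der_add[of i P "- Q"] by (simp add: partial_der_uminus)

lemma minus_single_add:
  assumes "Poly_Mapping.lookup m i > 0"
  shows "m - Poly_Mapping.single i 1 + m' = m + m' - Poly_Mapping.single i (1::nat)"
  using assms by (intro poly_mapping_eqI) (auto simp: lookup_add lookup_minus lookup_single when_def)

lemma minus_single_cancel:
  "Poly_Mapping.lookup m i > 0 \<Longrightarrow> m - Poly_Mapping.single i 1 + Poly_Mapping.single i (1::nat) = m"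
  by (intro poly_mapping_eqI) (auto simp: lookup_add lookup_minus lookup_single when_def)

lemma partial_der_mult:
  "partial_der i (P * Q) = partial_der i P * Q + P * partial_der i (Q :: ('v, 'a::comm_semiring_1) mpoly)"
proof -
  have single2: "partial_der i (Poly_Mapping.single m c * Poly_Mapping.single m' c') =
     partial_der i (Poly_Mapping.single m c) * Poly_Mapping.single m' c' +
     Poly_Mapping.single m c * partial_der i (Poly_Mapping.single m' c')" for m m' and c c' :: 'a
  proof -
    let ?e = "Poly_Mapping.single i (1::nat)"
    have 1: "Poly_Mapping.single (m - ?e + m') (c * of_nat (Poly_Mapping.lookup m i) * c') =
        Poly_Mapping.single (m + m' - ?e) (c * of_nat (Poly_Mapping.lookup m i) * c')"
      by (cases "Poly_Mapping.lookup m i > 0") (simp_all add: minus_single_add[of m i m', simplified])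
    have 2: "Poly_Mapping.single (m + (m' - ?e)) (c * (c' * of_nat (Poly_Mapping.lookup m' i))) =
        Poly_Mapping.single (m + m' - ?e) (c * (c' * of_nat (Poly_Mapping.lookup m' i)))"
      by (cases "Poly_Mapping.lookup m' i > 0")
         (simp_all add: minus_single_add[of m' i m, simplified] add.commute[of m])
    show ?thesis
      using 1 2 by (simp add: mult_single lookup_add algebra_simps flip: single_add)
  qed
  have single: "partial_der i (Poly_Mapping.single m c * Q) =
     partial_der i (Poly_Mapping.single m c) * Q + Poly_Mapping.single m c * partial_der i Q" for m c
    using mpolys_UNIV[of Q]
    by (induction Q rule: mpolys_induct)
       (simp_all add: distrib_left partial_der_add single2 add_ac del: partial_der_single)
  show ?thesis
    using mpolys_UNIV[of P]
    by (induction P rule: mpolys_induct)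
       (simp_all add: distrib_right partial_der_add single add_ac del: partial_der_single)
qed

lemma partial_der_in_mpolys:
  assumes R: "is_subring R" and P: "P \<in> mpolys R J"
  shows "partial_der i P \<in> mpolys R J"
  unfolding partial_der_def
proof (intro mpolys_sum[OF R] mpolys_single subring_mult[OF R] subring_of_nat[OF R])
  fix m assume m: "m \<in> Poly_Mapping.keys P"
  then show "Poly_Mapping.lookup P m \<in> R" using P by (simp add: mpolys_def)
  have "Poly_Mapping.keys (m - Poly_Mapping.single i 1) \<subseteq> Poly_Mapping.keys m"
    by (auto simp: in_keys_iff lookup_minus)
  then show "Poly_Mapping.keys (m - Poly_Mapping.single i 1) \<subseteq> J"
    using P m by (auto simp: mpolys_def)
qed

lemma derivation_mpoly_eval:
  assumes D: "derivation D" and k: "\<And>c. c \<in> k \<Longrightarrow> D c = 0" and J: "finite J" and P: "P \<in> mpolys k J"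
  shows "D (mpoly_eval v P) = (\<Sum>i\<in>J. mpoly_eval v (partial_der i P) * D (v i))"
  using P
proof (induction P rule: mpolys_induct)
  case zero
  then show ?case using D by simp
next
  case (add P m c)
  have "D (mono_eval v m) = (\<Sum>i\<in>J. D (v i ^ Poly_Mapping.lookup m i) * (\<Prod>j\<in>J - {i}. v j ^ Poly_Mapping.lookup m j))"
    unfolding mono_eval_superset[OF J add.hyps(3)] by (rule derivation_prod[OF D J])
  also have "\<dots> = (\<Sum>i\<in>J. of_nat (Poly_Mapping.lookup m i) * mono_eval v (m - Poly_Mapping.single i 1) * D (v i))"
  proof (rule sum.cong[OF refl])
    fix i assume i: "i \<in> J"
    have sub: "Poly_Mapping.keys (m - Poly_Mapping.single i 1) \<subseteq> J"
      using add.hyps(3) by (auto simp: in_keys_iff lookup_minus)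
    have "mono_eval v (m - Poly_Mapping.single i 1) =
        v i ^ (Poly_Mapping.lookup m i - 1) * (\<Prod>j\<in>J - {i}. v j ^ Poly_Mapping.lookup m j)"
      unfolding mono_eval_superset[OF J sub] prod.remove[OF J i]
      by (intro arg_cong2[of _ _ _ _ "(*)"] prod.cong) (auto simp: lookup_minus lookup_single when_def)
    then show "D (v i ^ Poly_Mapping.lookup m i) * (\<Prod>j\<in>J - {i}. v j ^ Poly_Mapping.lookup m j) =
        of_nat (Poly_Mapping.lookup m i) * mono_eval v (m - Poly_Mapping.single i 1) * D (v i)"
      by (simp add: derivation_power[OF D] mult_ac)
  qed
  finally have "D (c * mono_eval v m) =
      (\<Sum>i\<in>J. c * of_nat (Poly_Mapping.lookup m i) * mono_eval v (m - Poly_Mapping.single i 1) * D (v i))"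
    using k[OF add.hyps(2)] by (simp add: derivation_mult[OF D] sum_distrib_left mult_ac)
  then show ?case
    using add.IH
    by (simp add: mpoly_eval_add derivation_add[OF D] partial_der_add distrib_right sum.distrib)
qed

definition total_deg :: "('v \<Rightarrow>\<^sub>0 nat) \<Rightarrow> nat" where
  "total_deg m = (\<Sum>i\<in>Poly_Mapping.keys m. Poly_Mapping.lookup m i)"

lemma total_deg_minus_single:
  assumes "Poly_Mapping.lookup m i > 0"
  shows "total_deg (m - Poly_Mapping.single i 1) < total_deg m"
proof -
  have i: "i \<in> Poly_Mapping.keys m" using assms by (simp add: in_keys_iff)
  have "total_deg (m - Poly_Mapping.single i 1) =
      (\<Sum>j\<in>Poly_Mapping.keys m. Poly_Mapping.lookup (m - Poly_Mapping.single i 1) j)"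
    unfolding total_deg_def
    by (intro sum.mono_neutral_left) (auto simp: in_keys_iff lookup_minus)
  also have "\<dots> < total_deg m"
    unfolding total_deg_def using i assms
    by (intro sum_strict_mono_ex1) (auto simp: lookup_minus lookup_single intro!: bexI[of _ i])
  finally show ?thesis .
qed

lemma keys_partial_der:
  assumes "m \<in> Poly_Mapping.keys (partial_der i P)"
  obtains m' where "m' \<in> Poly_Mapping.keys P" "Poly_Mapping.lookup m' i > 0" "m = m' - Poly_Mapping.single i 1"
proof -
  have "Poly_Mapping.lookup (partial_der i P) m \<noteq> 0" using assms by (simp add: in_keys_iff)
  then obtain m' where m': "m' \<in> Poly_Mapping.keys P"
    "Poly_Mapping.lookup (Poly_Mapping.single (m' - Poly_Mapping.single i 1)
      (Poly_Mapping.lookup P m' * of_nat (Poly_Mapping.lookup m' i))) m \<noteq> 0"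
    unfolding partial_der_def lookup_sum by (rule sum.not_neutral_contains_not_neutral)
  then have "m = m' - Poly_Mapping.single i 1" "Poly_Mapping.lookup m' i \<noteq> 0"
    by (auto simp: lookup_single when_def split: if_splits intro: gr0I)
  with m' that show thesis by simp
qed

text \<open>Lowering the exponent of \<open>i\<close> is injective on the monomials that contain
  \<open>i\<close>, so no two terms of the derivative can cancel. In characteristic zero a variable
  that occurs therefore leaves a nonzero partial derivative.\<close>

lemma lookup_partial_der:
  assumes "Poly_Mapping.lookup m i > 0"
  shows "Poly_Mapping.lookup (partial_der i P) (m - Poly_Mapping.single i 1) =
    Poly_Mapping.lookup P m * of_nat (Poly_Mapping.lookup m i)"
proof -
  let ?e = "Poly_Mapping.single i (1::nat)"
  let ?t = "\<lambda>m'. Poly_Mapping.lookup (Poly_Mapping.single (m' - ?e)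
      (Poly_Mapping.lookup P m' * of_nat (Poly_Mapping.lookup m' i))) (m - ?e)"
  have "?t m' = 0" if "m' \<noteq> m" for m'
  proof (cases "Poly_Mapping.lookup m' i > 0 \<and> m' - ?e = m - ?e")
    case True
    then have "m' = m" using minus_single_cancel[of m i] minus_single_cancel[of m' i] assms by metis
    then show ?thesis using that by simp
  next
    case False
    then show ?thesis by (auto simp: lookup_single when_def)
  qed
  then have "(\<Sum>m'\<in>Poly_Mapping.keys P. ?t m') = (\<Sum>m'\<in>Poly_Mapping.keys P. if m' = m then ?t m else 0)"
    by (intro sum.cong) auto
  also have "\<dots> = Poly_Mapping.lookup P m * of_nat (Poly_Mapping.lookup m i)"
    by (simp add: in_keys_iff)
  finally show ?thesis by (simp add: partial_der_def lookup_sum)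
qed

text \<open>The relation is the differential of a polynomial relation of minimal degree.\<close>

lemma linear_relation_of_polynomial:
  fixes v :: "'v \<Rightarrow> 'a::field_char_0"
  assumes k: "is_subring k" and P: "P \<in> mpolys k J" "P \<noteq> 0" "mpoly_eval v P = 0"
  shows "\<exists>J0 a. finite J0 \<and> J0 \<subseteq> J \<and> (\<exists>i\<in>J0. a i \<noteq> 0) \<and>
    (\<forall>D. derivation D \<longrightarrow> (\<forall>c\<in>k. D c = 0) \<longrightarrow> (\<Sum>i\<in>J0. a i * D (v i)) = 0)"
proof -
  define Z where "Z N \<longleftrightarrow> (\<exists>P\<in>mpolys k J. P \<noteq> 0 \<and> mpoly_eval v P = 0 \<and>
    (\<forall>m\<in>Poly_Mapping.keys P. total_deg m \<le> N))" for N
  have "Z (Max (total_deg ` Poly_Mapping.keys P))" using P unfolding Z_def by (intro bexI[of _ P]) auto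
  then have "Z (LEAST N. Z N)" by (rule LeastI)
  moreover define N where "N = (LEAST N. Z N)"
  ultimately obtain Q where Q: "Q \<in> mpolys k J" "Q \<noteq> 0" "mpoly_eval v Q = 0"
    "\<And>m. m \<in> Poly_Mapping.keys Q \<Longrightarrow> total_deg m \<le> N"
    unfolding Z_def by blast
  have minZ: "\<not> Z M" if "M < N" for M using that not_less_Least unfolding N_def by blast
  have "\<exists>m\<in>Poly_Mapping.keys Q. m \<noteq> 0"
  proof (rule ccontr)
    assume "\<not> ?thesis"
    then have sub: "Poly_Mapping.keys Q \<subseteq> {0}" by auto
    then have "Poly_Mapping.keys Q = {0}" using Q(2) by (metis keys_eq_empty subset_singletonD)
    moreover have "Poly_Mapping.lookup Q 0 \<noteq> 0" using calculation by (auto simp flip: in_keys_iff)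
    ultimately show False using Q(3) by (simp add: mpoly_eval_def)
  qed
  then obtain m where m: "m \<in> Poly_Mapping.keys Q" "m \<noteq> 0" by blast
  then obtain i where i: "Poly_Mapping.lookup m i > 0"
    by (metis gr0I lookup_zero poly_mapping_eqI)
  have "Poly_Mapping.lookup (partial_der i Q) (m - Poly_Mapping.single i 1) \<noteq> 0"
    unfolding lookup_partial_der[OF i] using m i by (simp add: in_keys_iff)
  then have nz: "partial_der i Q \<noteq> 0" by auto
  \<comment> \<open>A nonzero polynomial of smaller degree that vanished at \<open>v\<close> would
    contradict the choice of \<open>N\<close>.\<close>
  have "mpoly_eval v (partial_der i Q) \<noteq> 0"
  proof
    assume "mpoly_eval v (partial_der i Q) = 0"
    moreover have "total_deg m' \<le> N - 1" if "m' \<in> Poly_Mapping.keys (partial_der i Q)" for m'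
      using that
    proof (rule keys_partial_der)
      fix m'' assume "m'' \<in> Poly_Mapping.keys Q" "0 < Poly_Mapping.lookup m'' i" "m' = m'' - Poly_Mapping.single i 1"
      then show ?thesis using total_deg_minus_single[of m'' i] Q(4)[of m''] by simp
    qed
    ultimately have "Z (N - 1)"
      unfolding Z_def using nz partial_der_in_mpolys[OF k Q(1)] by blast
    moreover have "N > 0" using total_deg_minus_single[OF i] Q(4)[OF m(1)] by simp
    ultimately show False using minZ[of "N - 1"] by simp
  qed
  moreover define J0 where "J0 = (\<Union>m\<in>Poly_Mapping.keys Q. Poly_Mapping.keys m)"
  have J0: "finite J0" "J0 \<subseteq> J" "Q \<in> mpolys k J0" using Q(1) by (auto simp: J0_def mpolys_def)
  moreover have "i \<in> J0" using m i by (auto simp: J0_def in_keys_iff)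
  moreover have "(\<Sum>i\<in>J0. mpoly_eval v (partial_der i Q) * D (v i)) = 0"
    if "derivation D" "\<forall>c\<in>k. D c = 0" for D
    using derivation_mpoly_eval[OF that(1) _ J0(1,3), of v] that Q(3) by simp
  ultimately show ?thesis
    by (intro exI[of _ J0] exI[of _ "\<lambda>i. mpoly_eval v (partial_der i Q)"]) blast
qed

text \<open>Without relations the partial derivative with respect to \<open>v i\<close> is well
  defined on values of polynomials. Extended to the ambient field, it kills \<open>k\<close> and
  every other \<open>v j\<close> but takes \<open>v i\<close> to \<open>1\<close>.\<close>

lemma der_independent_of_polynomial:
  fixes v :: "'v \<Rightarrow> 'a::field_char_0"
  assumes k: "is_subring k" and v: "\<And>P. P \<in> mpolys k J \<Longrightarrow> mpoly_eval v P = 0 \<Longrightarrow> P = 0"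
  shows "der_independent k v J"
  unfolding der_independent_def
proof
  fix i assume i: "i \<in> J"
  define G where "G = {(mpoly_eval v P, mpoly_eval v (partial_der i P)) | P. P \<in> mpolys k J}"
  have GI: "(a, b) \<in> G" if "P \<in> mpolys k J" "a = mpoly_eval v P" "b = mpoly_eval v (partial_der i P)" for a b P
    using that G_def by blast
  have const: "(c, 0) \<in> G" if "c \<in> k" for c
    using that by (intro GI[of "Poly_Mapping.single 0 c"]) (auto simp: mpolys_single mpoly_eval_const)
  have var: "(v j, if j = i then 1 else 0) \<in> G" if "j \<in> J" for j
    using that subring_one[OF k]
    by (intro GI[of "Poly_Mapping.single (Poly_Mapping.single j 1) 1"])
       (auto simp: mpolys_single mono_eval_def lookup_single)
  have "der_graph G"
    unfolding der_graph_def
  proof (intro conjI allI impI)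
    show "(1, 0) \<in> G" using const subring_one[OF k] by blast
  next
    fix b assume "(0, b) \<in> G"
    then obtain P where P: "P \<in> mpolys k J" "mpoly_eval v P = 0" "b = mpoly_eval v (partial_der i P)"
      unfolding G_def by auto
    have "P = 0" using v P by blast
    then show "b = 0" using P(3) by simp
  next
    fix a a' b b' assume "(a, a') \<in> G" "(b, b') \<in> G"
    then obtain P Q where PQ: "P \<in> mpolys k J" "a = mpoly_eval v P" "a' = mpoly_eval v (partial_der i P)"
      "Q \<in> mpolys k J" "b = mpoly_eval v Q" "b' = mpoly_eval v (partial_der i Q)"
      unfolding G_def by blast
    show "(a - b, a' - b') \<in> G"
      by (rule GI[OF mpolys_diff[OF k PQ(1,4)]]) (simp_all add: PQ mpoly_eval_diff partial_der_diff)
    show "(a * b, a' * b + a * b') \<in> G"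
      by (rule GI[OF mpolys_mult[OF k PQ(1,4)]])
         (simp_all add: PQ mpoly_eval_mult mpoly_eval_add partial_der_mult)
  qed
  then obtain D where D: "derivation D" "\<forall>(a, b) \<in> G. D a = b"
    using derivation_extension by blast
  show "v i \<notin> der_closure k (v ` (J - {i}))"
  proof
    assume mem: "v i \<in> der_closure k (v ` (J - {i}))"
    have "D c = 0" if "c \<in> k" for c using D(2) const[OF that] by auto
    moreover have "D (v j) = 0" if "j \<in> J - {i}" for j using D(2) var[of j] that by auto
    ultimately have "D (v i) = 0" by (intro der_closureD[OF mem D(1)]) auto
    moreover have "D (v i) = 1" using D(2) var[OF i] by auto
    ultimately show False by simp
  qed
qed

section \<open>Jets and differential dependence\<close>

definition jet :: "('a \<Rightarrow> 'a) \<Rightarrow> ('i \<Rightarrow> 'a) \<Rightarrow> 'i \<times> nat \<Rightarrow> 'a" where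
  "jet E u v = (E ^^ snd v) (u (fst v))"

definition jets :: "('a \<Rightarrow> 'a) \<Rightarrow> ('i \<Rightarrow> 'a) \<Rightarrow> 'i set \<Rightarrow> nat \<Rightarrow> 'a set" where
  "jets E u I m = jet E u ` (I \<times> {..<m})"

lemma dpoly_eval_eq: "dpoly_eval E u P = mpoly_eval (jet E u) P"
  by (simp add: dpoly_eval_def mpoly_eval_def mono_eval_def jet_def)

lemma dpolys_eq: "dpolys R I = mpolys R (I \<times> UNIV)"
  by (simp add: dpolys_def mpolys_def)

lemma jetsI: "i \<in> I \<Longrightarrow> j < m \<Longrightarrow> (E ^^ j) (u i) \<in> jets E u I m"
  unfolding jets_def jet_def by (rule image_eqI[of _ _ "(i, j)"]) auto

lemma jetsE:
  assumes "a \<in> jets E u I m"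
  obtains i j where "i \<in> I" "j < m" "a = (E ^^ j) (u i)"
  using assms unfolding jets_def jet_def by auto

lemma jets_mono: "I \<subseteq> J \<Longrightarrow> l \<le> m \<Longrightarrow> jets E u I l \<subseteq> jets E u J m"
  unfolding jets_def by (rule image_mono) auto

lemma jets_derivation: "E ` jets E u I m \<subseteq> jets E u I (Suc m)"
proof
  fix b assume "b \<in> E ` jets E u I m"
  then obtain i j where "i \<in> I" "j < m" "b = E ((E ^^ j) (u i))" by (auto elim: jetsE)
  then show "b \<in> jets E u I (Suc m)" using jetsI[of i I "Suc j" "Suc m" E u] by simp
qed

lemma finite_jets: "finite I \<Longrightarrow> finite (jets E u I m)"
  by (simp add: jets_def)

lemma card_jets_le: "finite I \<Longrightarrow> card (jets E u I m) \<le> card I * m"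
  unfolding jets_def using card_image_le[of "I \<times> {..<m}" "jet E u"] by (simp add: card_cartesian_product)

lemma jets_id_singleton: "jets E id {b} r = (\<lambda>j. (E ^^ j) b) ` {..<r}"
  by (force simp: jets_def jet_def)

text \<open>Differentiating the dependence of the \<open>r\<close>-th derivative raises the order
  needed from \<open>u\<close> by one each time, while the jets of \<open>b\<close> needed remain
  the first \<open>r\<close>. Thus \<open>b\<close> contributes a constant to every later
  count.\<close>

lemma der_closure_jets_tail:
  assumes E: "derivation E" and k: "\<And>c. c \<in> k \<Longrightarrow> E c \<in> k"
    and b: "(E ^^ r) b \<in> der_closure k (jets E u I q \<union> jets E id {b} r)"
  shows "(E ^^ j) b \<in> der_closure k (jets E u I (q + j) \<union> jets E id {b} r)"
proof -
  have tail: "(E ^^ (r + s)) b \<in> der_closure k (jets E u I (q + s) \<union> jets E id {b} r)" for s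
  proof (induction s)
    case 0
    show ?case using b by (simp only: add_0_right)
  next
    case (Suc s)
    let ?A = "jets E u I (q + s) \<union> jets E id {b} r"
    let ?B = "der_closure k (jets E u I (q + Suc s) \<union> jets E id {b} r)"
    have mono: "jets E u I m \<subseteq> ?B" if "m \<le> q + Suc s" for m
      by (rule order.trans[OF jets_mono[OF subset_refl that] order.trans[OF Un_upper1 der_closure_incl]])
    have incl: "jets E id {b} r \<subseteq> ?B" by (rule order.trans[OF Un_upper2 der_closure_incl])
    have "E ` jets E id {b} r \<subseteq> ?B"
    proof
      fix a assume "a \<in> E ` jets E id {b} r"
      then have "a \<in> (\<lambda>j. E ((E ^^ j) b)) ` {..<r}" by (simp add: jets_id_singleton image_image)
      then obtain l where l: "l < r" "a = (E ^^ Suc l) b" by (auto elim!: imageE)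
      show "a \<in> ?B"
      proof (cases "Suc l < r")
        case True
        then have "a \<in> jets E id {b} r" unfolding l(2) jets_id_singleton by blast
        then show ?thesis using incl by blast
      next
        \<comment> \<open>Only the derivative of the last stored jet leaves the list, and there the
          hypothesis on \<open>b\<close> takes over.\<close>
        case False
        then have "Suc l = r" using l(1) by simp
        then have "a = (E ^^ r) b" using l(2) by (simp only:)
        moreover have "jets E u I q \<union> jets E id {b} r \<subseteq> ?B"
          using mono[of q] incl by simp
        ultimately show ?thesis using b der_closure_trans by metis
      qed
    qed
    moreover have "E ` jets E u I (q + s) \<subseteq> ?B"
      using jets_derivation[of E u I "q + s"] mono[of "q + Suc s"] by auto
    moreover have "?A \<subseteq> ?B" using mono[of "q + s"] incl by simp
    ultimately have "?A \<union> E ` ?A \<subseteq> ?B" by (simp add: image_Un)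
    moreover have "E ((E ^^ (r + s)) b) \<in> der_closure k (?A \<union> E ` ?A)"
      by (rule der_closure_derivation[OF E k Suc.IH])
    ultimately have "E ((E ^^ (r + s)) b) \<in> ?B" by (rule der_closure_trans)
    moreover have "(E ^^ (r + Suc s)) b = E ((E ^^ (r + s)) b)" by simp
    ultimately show ?case by (simp only:)
  qed
  show ?thesis
  proof (cases "j < r")
    case True
    then have "(E ^^ j) b \<in> jets E u I (q + j) \<union> jets E id {b} r" by (auto simp: jets_id_singleton)
    then show ?thesis by (rule subsetD[OF der_closure_incl])
  next
    case False
    have "jets E u I (q + (j - r)) \<union> jets E id {b} r \<subseteq> jets E u I (q + j) \<union> jets E id {b} r"
      using jets_mono[of I I "q + (j - r)" "q + j" E u] by auto
    moreover have "(E ^^ j) b \<in> der_closure k (jets E u I (q + (j - r)) \<union> jets E id {b} r)"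
      using tail[of "j - r"] False by simp
    ultimately show ?thesis by (rule subsetD[OF der_closure_mono])
  qed
qed

lemma der_closure_jets_iter:
  assumes E: "derivation E" and k: "\<And>c. c \<in> k \<Longrightarrow> E c \<in> k"
    and b: "b \<in> der_closure k (jets E u I m)"
  shows "(E ^^ j) b \<in> der_closure k (jets E u I (m + j))"
  using der_closure_jets_tail[OF E k, of 0 b u I m j] b by (simp add: jets_def)

lemma der_independent_jets:
  fixes u :: "'i \<Rightarrow> 'a::field_char_0"
  assumes "is_subring k" "diff_alg_independent E k u I"
  shows "der_independent k (jet E u) (I \<times> UNIV)"
  using assms by (intro der_independent_of_polynomial)
    (auto simp: diff_alg_independent_def dpolys_eq dpoly_eval_eq)

lemma der_independent_subset:
  assumes "der_independent k v I" "J \<subseteq> I"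
  shows "der_independent k v J"
  unfolding der_independent_def
proof
  fix i assume i: "i \<in> J"
  have "der_closure k (v ` (J - {i})) \<subseteq> der_closure k (v ` (I - {i}))"
    using assms(2) by (intro der_closure_mono) auto
  then show "v i \<notin> der_closure k (v ` (J - {i}))"
    using assms i unfolding der_independent_def by blast
qed

text \<open>The tool for all comparisons of growth: when \<open>A\<close> is allowed to depend on
  \<open>m\<close>, a linear bound on its size bounds \<open>card I\<close> by the slope.\<close>

lemma diff_independent_card_le:
  fixes u :: "'i \<Rightarrow> 'a::field_char_0"
  assumes "is_subring k" "diff_alg_independent E k u I" "finite I" "finite A"
    and "jets E u I m \<subseteq> der_closure k A"
  shows "card I * m \<le> card A"
proof -
  have "der_independent k (jet E u) (I \<times> {..<m})"
    by (rule der_independent_subset[OF der_independent_jets[OF assms(1,2)]]) auto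
  from der_independent_card_le[OF this _ assms(4)] show ?thesis
    using assms(3,5) by (simp add: jets_def card_cartesian_product)
qed

lemma linear_relation_of_diff_dependent:
  fixes u :: "'i \<Rightarrow> 'a::field_char_0"
  assumes k: "is_subring k" and dep: "\<not> diff_alg_independent E k u I"
  obtains J a where "finite J" "J \<subseteq> I \<times> UNIV" "\<exists>v\<in>J. a v \<noteq> 0"
    "\<And>D. derivation D \<Longrightarrow> \<forall>c\<in>k. D c = 0 \<Longrightarrow> (\<Sum>v\<in>J. a v * D (jet E u v)) = 0"
proof -
  obtain P where "P \<in> mpolys k (I \<times> UNIV)" "mpoly_eval (jet E u) P = 0" "P \<noteq> 0"
    using dep by (auto simp: diff_alg_independent_def dpolys_eq dpoly_eval_eq)
  from linear_relation_of_polynomial[OF k this(1,3,2)] that show ?thesis by blast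
qed

text \<open>A derivation that kills \<open>A\<close> leaves a single term of the relation,
  \<open>a v0 * D (w v0)\<close>.\<close>

lemma der_closure_of_linear_relation:
  assumes "finite J" "v0 \<in> J" "a v0 \<noteq> 0"
    and rel: "\<And>D. derivation D \<Longrightarrow> \<forall>c\<in>k. D c = 0 \<Longrightarrow> (\<Sum>v\<in>J. a v * D (w v)) = 0"
    and A: "\<And>v. v \<in> J \<Longrightarrow> v \<noteq> v0 \<Longrightarrow> a v \<noteq> 0 \<Longrightarrow> w v \<in> A"
  shows "w v0 \<in> der_closure k A"
proof (rule der_closureI)
  fix D assume D: "derivation D" "\<And>c. c \<in> k \<Longrightarrow> D c = 0" "\<And>c. c \<in> A \<Longrightarrow> D c = 0"
  have "(\<Sum>v\<in>J. a v * D (w v)) = (\<Sum>v\<in>J. if v = v0 then a v0 * D (w v0) else 0)"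
    using A D(3) by (intro sum.cong) auto
  also have "\<dots> = a v0 * D (w v0)" using assms(1,2) by simp
  finally show "D (w v0) = 0" using rel[OF D(1)] D(2) assms(3) by simp
qed

text \<open>The solved variable is a leader for an orderly ranking: no jet in the relation has
  higher order, and those of the same indeterminate have smaller order.\<close>

lemma diff_dependent_top_jet:
  fixes u :: "'i \<Rightarrow> 'a::field_char_0"
  assumes k: "is_subring k" and dep: "\<not> diff_alg_independent E k u I"
  shows "\<exists>i\<in>I. \<exists>r. (E ^^ r) (u i) \<in> der_closure k (jets E u (I - {i}) (Suc r) \<union> jets E id {u i} r)"
proof -
  obtain J a where J: "finite J" "J \<subseteq> I \<times> UNIV" "\<exists>v\<in>J. a v \<noteq> 0"
    "\<And>D. derivation D \<Longrightarrow> \<forall>c\<in>k. D c = 0 \<Longrightarrow> (\<Sum>v\<in>J. a v * D (jet E u v)) = 0"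
    using linear_relation_of_diff_dependent[OF k dep] by blast
  define N where "N = {v \<in> J. a v \<noteq> 0}"
  have N: "finite N" "N \<noteq> {}" using J by (auto simp: N_def)
  define r where "r = Max (snd ` N)"
  have "r \<in> snd ` N" unfolding r_def using N by (intro Max_in) auto
  then obtain i where i: "(i, r) \<in> N" by auto
  have le: "snd v \<le> r" if "v \<in> N" for v unfolding r_def using N that by (intro Max_ge) auto
  have "jet E u (i, r) \<in> der_closure k (jets E u (I - {i}) (Suc r) \<union> jets E id {u i} r)"
  proof (rule der_closure_of_linear_relation[OF J(1) _ _ J(4)])
    show "(i, r) \<in> J" "a (i, r) \<noteq> 0" using i by (auto simp: N_def)
    fix v assume v: "v \<in> J" "v \<noteq> (i, r)" "a v \<noteq> 0"
    then have "v \<in> N" by (simp add: N_def)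
    then have "snd v \<le> r" by (rule le)
    obtain i' j where v': "v = (i', j)" by (cases v)
    show "jet E u v \<in> jets E u (I - {i}) (Suc r) \<union> jets E id {u i} r"
    proof (cases "i' = i")
      case True
      then have "j < r" using v v' \<open>snd v \<le> r\<close> by simp
      then show ?thesis using True v' by (auto simp: jets_id_singleton jet_def)
    next
      case False
      then have "(E ^^ j) (u i') \<in> jets E u (I - {i}) (Suc r)"
        using v v' \<open>snd v \<le> r\<close> J(2) by (intro jetsI) auto
      then show ?thesis using v' by (simp add: jet_def)
    qed
  qed
  moreover have "i \<in> I" using i J(2) by (auto simp: N_def)
  ultimately show ?thesis by (auto simp: jet_def)
qed

text \<open>Here \<open>b\<close> is ranked above all of \<open>S\<close>: \<open>r\<close> is the
  order of the relation in \<open>b\<close>, and the orders in \<open>S\<close> are merely bounded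
  by \<open>q\<close>. The relation must involve \<open>b\<close>, as otherwise the jets of
  \<open>S\<close> would be dependent.\<close>

lemma diff_dependent_insert_jet:
  fixes b :: "'a::field_char_0"
  assumes k: "is_subring k" and S: "diff_alg_independent E k id S"
    and dep: "\<not> diff_alg_independent E k id (insert b S)"
  shows "\<exists>q r. (E ^^ r) b \<in> der_closure k (jets E id S q \<union> jets E id {b} r)"
proof -
  obtain J a where J: "finite J" "J \<subseteq> insert b S \<times> UNIV" "\<exists>v\<in>J. a v \<noteq> 0"
    "\<And>D. derivation D \<Longrightarrow> \<forall>c\<in>k. D c = 0 \<Longrightarrow> (\<Sum>v\<in>J. a v * D (jet E id v)) = 0"
    using linear_relation_of_diff_dependent[OF k dep] by blast
  define N where "N = {j. (b, j) \<in> J \<and> a (b, j) \<noteq> 0}"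
  have finN: "finite N"
    by (rule finite_subset[of _ "snd ` J"]) (use J(1) in \<open>force simp: N_def\<close>)+
  have "N \<noteq> {}"
  proof
    assume N: "N = {}"
    obtain v where v: "v \<in> J" "a v \<noteq> 0" using J(3) by blast
    have JS: "v' \<in> S \<times> UNIV" if "v' \<in> J" "a v' \<noteq> 0" for v'
      using that J(2) N by (cases v') (auto simp: N_def)
    have "jet E id v \<in> der_closure k (jet E id ` (S \<times> UNIV - {v}))"
      by (rule der_closure_of_linear_relation[where J = J, OF J(1) v J(4)]) (use JS in auto)
    then show False
      using der_independent_jets[OF k S] JS[OF v] unfolding der_independent_def by blast
  qed
  define r where "r = Max N"
  have "r \<in> N" unfolding r_def using finN \<open>N \<noteq> {}\<close> by (rule Max_in)
  then have r: "(b, r) \<in> J" "a (b, r) \<noteq> 0" by (auto simp: N_def)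
  define q where "q = Suc (Max (snd ` J))"
  have "jet E id (b, r) \<in> der_closure k (jets E id S q \<union> jets E id {b} r)"
  proof (rule der_closure_of_linear_relation[where J = J, OF J(1) r J(4)])
    fix v assume v: "v \<in> J" "v \<noteq> (b, r)" "a v \<noteq> 0"
    obtain s j where v': "v = (s, j)" by (cases v)
    have "j < q" unfolding q_def less_Suc_eq_le using J(1) v v' by (intro Max_ge) force+
    show "jet E id v \<in> jets E id S q \<union> jets E id {b} r"
    proof (cases "s = b")
      case True
      then have "j \<in> N" using v v' by (simp add: N_def)
      then have "j \<le> r" unfolding r_def using finN by simp
      then have "j < r" using v v' True by auto
      then show ?thesis using True v' by (auto simp: jets_id_singleton jet_def)
    next
      case False
      then have "(E ^^ j) (id s) \<in> jets E id S q" using v v' J(2) \<open>j < q\<close> by (intro jetsI) auto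
      then show ?thesis using v' by (simp add: jet_def)
    qed
  qed
  then show ?thesis by (auto simp: jet_def)
qed

lemma diff_alg_independent_mono:
  assumes "diff_alg_independent E R u J" "I \<subseteq> J"
  shows "diff_alg_independent E R u I"
proof -
  have "dpolys R I \<subseteq> dpolys R J"
    unfolding dpolys_eq using assms(2) by (intro mpolys_mono) auto
  then show ?thesis using assms(1) unfolding diff_alg_independent_def by (metis subsetD)
qed

text \<open>The chain rule with each variable \<open>(i, k)\<close> shifted to
  \<open>(i, Suc k)\<close>. \<open>P'\<close> is chosen before \<open>D\<close> and
  \<open>u\<close>; because the same \<open>P'\<close> serves for both derivations, a substitution
  intertwines them.\<close>

lemma formal_derivative:
  fixes k :: "'a::field set" and I :: "'i set"
  assumes k: "is_subring k" and P: "P \<in> dpolys k I"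
  shows "\<exists>P'\<in>dpolys k I. \<forall>D u. derivation D \<longrightarrow> (\<forall>c\<in>k. D c = 0) \<longrightarrow>
    D (dpoly_eval D u P) = dpoly_eval D u P'"
proof -
  define J where "J = (\<Union>m\<in>Poly_Mapping.keys P. Poly_Mapping.keys m)"
  have J: "finite J" "J \<subseteq> I \<times> UNIV" "P \<in> mpolys k J"
    using P by (auto simp: J_def mpolys_def dpolys_eq)
  define shift where "shift v = (fst v, Suc (snd v))" for v :: "'i \<times> nat"
  define P' where
    "P' = (\<Sum>v\<in>J. partial_der v P * Poly_Mapping.single (Poly_Mapping.single (shift v) 1) 1)"
  have "P' \<in> dpolys k I"
    unfolding P'_def dpolys_eq
  proof (intro mpolys_sum[OF k] mpolys_mult[OF k] mpolys_var subring_one[OF k])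
    fix v assume "v \<in> J"
    then show "shift v \<in> I \<times> UNIV" using J(2) by (auto simp: shift_def)
    show "partial_der v P \<in> mpolys k (I \<times> UNIV)"
      using partial_der_in_mpolys[OF k] P by (simp add: dpolys_eq)
  qed
  moreover have "D (dpoly_eval D u P) = dpoly_eval D u P'" if "derivation D" "\<forall>c\<in>k. D c = 0" for D u
  proof -
    have "mpoly_eval w (\<Sum>v\<in>V. f v) = (\<Sum>v\<in>V. mpoly_eval w (f v))"
      for w :: "'i \<times> nat \<Rightarrow> 'a" and V :: "('i \<times> nat) set" and f
      by (induction V rule: infinite_finite_induct) (auto simp: mpoly_eval_add)
    moreover have "D (jet D u v) = jet D u (shift v)" for v by (simp add: jet_def shift_def)
    ultimately show ?thesis
      unfolding dpoly_eval_eq P'_def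
      using derivation_mpoly_eval[OF that(1) _ J(1,3), of "jet D u"] that(2)
      by (simp add: mpoly_eval_mult mpoly_eval_var[simplified])
  qed
  ultimately show ?thesis by blast
qed

lemma dpoly_eval_const: "dpoly_eval D u (Poly_Mapping.single 0 c) = c"
  by (simp add: dpoly_eval_eq)

lemma dpoly_eval_one [simp]: "dpoly_eval D u 1 = 1"
  using dpoly_eval_const[of D u 1] by simp

lemma dpoly_eval_mult: "dpoly_eval D u (P * Q) = dpoly_eval D u P * dpoly_eval D u Q"
  and dpoly_eval_diff: "dpoly_eval D u (P - Q) = dpoly_eval D u P - dpoly_eval D u Q"
  by (simp_all add: dpoly_eval_eq mpoly_eval_mult mpoly_eval_diff)

lemma dpoly_eval_var: "dpoly_eval D u (Poly_Mapping.single (Poly_Mapping.single (i, 0) 1) 1) = u i"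
  using mpoly_eval_var[of "jet D u" "(i, 0)"] by (simp add: dpoly_eval_eq jet_def)

context
  fixes R :: "'a::field set"
  assumes R: "is_subring R"
begin

lemma dpolys_const: "c \<in> R \<Longrightarrow> Poly_Mapping.single 0 c \<in> dpolys R I"
  by (simp add: dpolys_eq mpolys_single)

lemma dpolys_var: "i \<in> I \<Longrightarrow> Poly_Mapping.single (Poly_Mapping.single (i, 0) 1) 1 \<in> dpolys R I"
  using subring_one[OF R] unfolding dpolys_eq by (intro mpolys_var) auto

lemma dpolys_mult: "P \<in> dpolys R I \<Longrightarrow> Q \<in> dpolys R I \<Longrightarrow> P * Q \<in> dpolys R I"
  and dpolys_diff: "P \<in> dpolys R I \<Longrightarrow> Q \<in> dpolys R I \<Longrightarrow> P - Q \<in> dpolys R I"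
  unfolding dpolys_eq by (simp_all add: mpolys_mult[OF R] mpolys_diff[OF R])

end

section \<open>Substitution in differential rational functions\<close>

text \<open>The two independence assumptions make the substitution a field homomorphism on
  \<open>L\<close>. Its values lie in the ambient field only, since \<open>E\<close> may involve
  elements that are not in \<open>L\<close>.\<close>

locale diff_substitution =
  fixes D E :: "'a::field \<Rightarrow> 'a" and R :: "'a set" and x y :: "'a^'n"
  assumes R: "is_subfield R"
    and D: "derivation D" "\<And>c. c \<in> R \<Longrightarrow> D c = 0"
    and E: "derivation E" "\<And>c. c \<in> R \<Longrightarrow> E c = 0"
    and x: "diff_alg_independent D R (($) x) UNIV"
    and y: "diff_alg_independent E R (($) y) UNIV"
begin

abbreviation "ex \<equiv> dpoly_eval D (($) x)"
abbreviation "ey \<equiv> dpoly_eval E (($) y)"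
abbreviation "L \<equiv> diff_rat_functions D R x"
abbreviation "\<sigma> \<equiv> diff_subst D R x E y"

lemma subring: "is_subring R"
  using R is_subfield_def by blast

lemma eval_nonzero:
  assumes "Q \<in> dpolys R UNIV" "ex Q \<noteq> 0"
  shows "ey Q \<noteq> 0"
  using assms y unfolding diff_alg_independent_def by (auto simp: dpoly_eval_eq)

text \<open>For two fractions of equal value the cross difference of numerators and denominators
  vanishes at \<open>x\<close>, so it is the zero polynomial by independence, and it vanishes at
  \<open>y\<close> as well.\<close>

lemma subst_fraction:
  assumes P: "P \<in> dpolys R UNIV" and Q: "Q \<in> dpolys R UNIV" "ex Q \<noteq> 0"
  shows "\<sigma> (ex P / ex Q) = ey P / ey Q"
  unfolding diff_subst_def
proof (rule the_equality)
  show "\<exists>P' Q'. P' \<in> dpolys R UNIV \<and> Q' \<in> dpolys R UNIV \<and> ex Q' \<noteq> 0 \<and>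
      ex P / ex Q = ex P' / ex Q' \<and> ey P / ey Q = ey P' / ey Q'"
    using assms by blast
next
  fix r assume "\<exists>P' Q'. P' \<in> dpolys R UNIV \<and> Q' \<in> dpolys R UNIV \<and> ex Q' \<noteq> 0 \<and>
      ex P / ex Q = ex P' / ex Q' \<and> r = ey P' / ey Q'"
  then obtain P' Q' where PQ': "P' \<in> dpolys R UNIV" "Q' \<in> dpolys R UNIV" "ex Q' \<noteq> 0"
    "ex P / ex Q = ex P' / ex Q'" "r = ey P' / ey Q'" by blast
  have "ex (P * Q' - P' * Q) = 0"
    using Q(2) PQ'(3,4) by (simp add: dpoly_eval_diff dpoly_eval_mult frac_eq_eq)
  then have "P * Q' - P' * Q = 0"
    using x dpolys_diff[OF subring dpolys_mult[OF subring P PQ'(2)] dpolys_mult[OF subring PQ'(1) Q(1)]]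
    unfolding diff_alg_independent_def by blast
  then have "ey (P * Q') = ey (P' * Q)" by simp
  then show "r = ey P / ey Q"
    using eval_nonzero[OF Q] eval_nonzero[OF PQ'(2,3)] PQ'(5)
    by (simp add: dpoly_eval_mult frac_eq_eq)
qed

lemma L_cases:
  assumes "f \<in> L"
  obtains P Q where "P \<in> dpolys R UNIV" "Q \<in> dpolys R UNIV" "ex Q \<noteq> 0" "f = ex P / ex Q"
    "ey Q \<noteq> 0" "\<sigma> f = ey P / ey Q"
proof -
  obtain P Q where PQ: "P \<in> dpolys R UNIV" "Q \<in> dpolys R UNIV" "ex Q \<noteq> 0" "f = ex P / ex Q"
    using assms unfolding diff_rat_functions_def by blast
  then show thesis using that[OF PQ eval_nonzero[OF PQ(2,3)]] subst_fraction[OF PQ(1-3)] by simp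
qed

lemma fraction_in_L:
  "P \<in> dpolys R UNIV \<Longrightarrow> Q \<in> dpolys R UNIV \<Longrightarrow> ex Q \<noteq> 0 \<Longrightarrow> ex P / ex Q \<in> L"
  unfolding diff_rat_functions_def by blast

lemma one_dpoly: "Poly_Mapping.single 0 1 \<in> dpolys R UNIV"
  by (intro dpolys_const subring_one subring)

lemma poly_in_L: "P \<in> dpolys R UNIV \<Longrightarrow> ex P \<in> L"
  using fraction_in_L[OF _ one_dpoly] by (simp add: dpoly_eval_const)

lemma subst_poly: "P \<in> dpolys R UNIV \<Longrightarrow> \<sigma> (ex P) = ey P"
  using subst_fraction[OF _ one_dpoly] by (simp add: dpoly_eval_const)

lemma const_in_L: "c \<in> R \<Longrightarrow> c \<in> L" and subst_const: "c \<in> R \<Longrightarrow> \<sigma> c = c"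
  using poly_in_L[OF dpolys_const[OF subring]] subst_poly[OF dpolys_const[OF subring]]
  by (auto simp: dpoly_eval_const)

lemma var_in_L: "x $ i \<in> L" and subst_var: "\<sigma> (x $ i) = y $ i"
  using poly_in_L[OF dpolys_var[OF subring UNIV_I]] subst_poly[OF dpolys_var[OF subring UNIV_I]]
  by (auto simp: dpoly_eval_var[simplified])

lemma diff_L: assumes "f \<in> L" "g \<in> L" shows "f - g \<in> L" and subst_diff: "\<sigma> (f - g) = \<sigma> f - \<sigma> g"
proof -
  obtain P Q where PQ: "P \<in> dpolys R UNIV" "Q \<in> dpolys R UNIV" "ex Q \<noteq> 0" "f = ex P / ex Q"
    "ey Q \<noteq> 0" "\<sigma> f = ey P / ey Q" by (rule L_cases[OF assms(1)])
  obtain P' Q' where PQ': "P' \<in> dpolys R UNIV" "Q' \<in> dpolys R UNIV" "ex Q' \<noteq> 0" "g = ex P' / ex Q'"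
    "ey Q' \<noteq> 0" "\<sigma> g = ey P' / ey Q'" by (rule L_cases[OF assms(2)])
  have num: "P * Q' - P' * Q \<in> dpolys R UNIV" and den: "Q * Q' \<in> dpolys R UNIV" "ex (Q * Q') \<noteq> 0"
    using PQ PQ' by (simp_all add: dpolys_mult[OF subring] dpolys_diff[OF subring] dpoly_eval_mult)
  have eq: "f - g = ex (P * Q' - P' * Q) / ex (Q * Q')"
    using PQ PQ' by (simp add: dpoly_eval_mult dpoly_eval_diff diff_frac_eq)
  show "f - g \<in> L" unfolding eq by (rule fraction_in_L[OF num den])
  show "\<sigma> (f - g) = \<sigma> f - \<sigma> g"
    unfolding eq subst_fraction[OF num den]
    using PQ PQ' by (simp add: dpoly_eval_mult dpoly_eval_diff diff_frac_eq)
qed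

lemma mult_L: assumes "f \<in> L" "g \<in> L" shows "f * g \<in> L" and subst_mult: "\<sigma> (f * g) = \<sigma> f * \<sigma> g"
proof -
  obtain P Q where PQ: "P \<in> dpolys R UNIV" "Q \<in> dpolys R UNIV" "ex Q \<noteq> 0" "f = ex P / ex Q"
    "ey Q \<noteq> 0" "\<sigma> f = ey P / ey Q" by (rule L_cases[OF assms(1)])
  obtain P' Q' where PQ': "P' \<in> dpolys R UNIV" "Q' \<in> dpolys R UNIV" "ex Q' \<noteq> 0" "g = ex P' / ex Q'"
    "ey Q' \<noteq> 0" "\<sigma> g = ey P' / ey Q'" by (rule L_cases[OF assms(2)])
  have num: "P * P' \<in> dpolys R UNIV" and den: "Q * Q' \<in> dpolys R UNIV" "ex (Q * Q') \<noteq> 0"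
    using PQ PQ' by (simp_all add: dpolys_mult[OF subring] dpoly_eval_mult)
  have eq: "f * g = ex (P * P') / ex (Q * Q')"
    using PQ PQ' by (simp add: dpoly_eval_mult)
  show "f * g \<in> L" unfolding eq by (rule fraction_in_L[OF num den])
  show "\<sigma> (f * g) = \<sigma> f * \<sigma> g"
    unfolding eq subst_fraction[OF num den] using PQ PQ' by (simp add: dpoly_eval_mult)
qed

lemma inverse_L: assumes "f \<in> L" shows "inverse f \<in> L" and subst_inverse: "\<sigma> (inverse f) = inverse (\<sigma> f)"
proof -
  obtain P Q where PQ: "P \<in> dpolys R UNIV" "Q \<in> dpolys R UNIV" "ex Q \<noteq> 0" "f = ex P / ex Q"
    "ey Q \<noteq> 0" "\<sigma> f = ey P / ey Q" by (rule L_cases[OF assms(1)])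
  have zero: "0 \<in> L" "\<sigma> 0 = 0"
    using const_in_L[OF subring_zero[OF subring]] subst_const[OF subring_zero[OF subring]] by auto
  have "inverse f \<in> L \<and> \<sigma> (inverse f) = inverse (\<sigma> f)"
  proof (cases "ex P = 0")
    case True
    then show ?thesis using zero PQ(4) by simp
  next
    case False
    have "inverse f = ex Q / ex P" using PQ by simp
    then show ?thesis
      using fraction_in_L[OF PQ(2,1) False] subst_fraction[OF PQ(2,1) False] PQ(6) by simp
  qed
  then show "inverse f \<in> L" "\<sigma> (inverse f) = inverse (\<sigma> f)" by auto
qed

lemma is_subfield_L: "is_subfield L"
  unfolding is_subfield_def is_subring_def
  using const_in_L[OF subring_zero[OF subring]] const_in_L[OF subring_one[OF subring]]
    diff_L(1) mult_L(1) inverse_L(1) by blast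

lemma is_subring_L: "is_subring L"
  using is_subfield_L is_subfield_def by blast

lemma subst_add: assumes "f \<in> L" "g \<in> L" shows "\<sigma> (f + g) = \<sigma> f + \<sigma> g"
  using subst_diff[OF subring_add[OF is_subring_L assms] assms(2)] by (simp add: algebra_simps)

lemma subst_sum: "(\<And>i. i \<in> I \<Longrightarrow> f i \<in> L) \<Longrightarrow> \<sigma> (\<Sum>i\<in>I. f i) = (\<Sum>i\<in>I. \<sigma> (f i))"
  by (induction I rule: infinite_finite_induct)
     (simp_all add: subst_const[OF subring_zero[OF subring]] subst_add subring_sum[OF is_subring_L])

lemma deriv_L: assumes "f \<in> L" shows "D f \<in> L" and subst_deriv: "\<sigma> (D f) = E (\<sigma> f)"
proof -
  obtain P Q where PQ: "P \<in> dpolys R UNIV" "Q \<in> dpolys R UNIV" "ex Q \<noteq> 0" "f = ex P / ex Q"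
    "ey Q \<noteq> 0" "\<sigma> f = ey P / ey Q" by (rule L_cases[OF assms(1)])
  have quotient: "G (a / b) = (G a * b - a * G b) / (b * b)" if "derivation G" "b \<noteq> 0" for G and a b :: 'a
  proof -
    have "G (a / b) = G a * inverse b + a * (- G b * inverse b * inverse b)"
      unfolding divide_inverse derivation_mult[OF that(1)] derivation_inverse[OF that] ..
    also have "\<dots> = (G a * b - a * G b) / (b * b)" using that(2) by (simp add: divide_simps)
    finally show ?thesis .
  qed
  obtain P' where P'0: "P' \<in> dpolys R UNIV"
    "\<forall>D u. derivation D \<longrightarrow> (\<forall>c\<in>R. D c = 0) \<longrightarrow> D (dpoly_eval D u P) = dpoly_eval D u P'"
    using formal_derivative[OF subring PQ(1)] by (elim bexE)
  have P': "P' \<in> dpolys R UNIV" "D (ex P) = ex P'" "E (ey P) = ey P'"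
    using P'0 D E by simp_all
  obtain Q' where Q'0: "Q' \<in> dpolys R UNIV"
    "\<forall>D u. derivation D \<longrightarrow> (\<forall>c\<in>R. D c = 0) \<longrightarrow> D (dpoly_eval D u Q) = dpoly_eval D u Q'"
    using formal_derivative[OF subring PQ(2)] by (elim bexE)
  have Q': "Q' \<in> dpolys R UNIV" "D (ex Q) = ex Q'" "E (ey Q) = ey Q'"
    using Q'0 D E by simp_all
  have num: "P' * Q - P * Q' \<in> dpolys R UNIV" and den: "Q * Q \<in> dpolys R UNIV" "ex (Q * Q) \<noteq> 0"
    using PQ P' Q' by (simp_all add: dpolys_mult[OF subring] dpolys_diff[OF subring] dpoly_eval_mult)
  have eq: "D f = ex (P' * Q - P * Q') / ex (Q * Q)"
    using PQ(3,4) P' Q' by (simp add: quotient[OF D(1)] dpoly_eval_mult dpoly_eval_diff)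
  show "D f \<in> L" unfolding eq by (rule fraction_in_L[OF num den])
  show "\<sigma> (D f) = E (\<sigma> f)"
    unfolding eq subst_fraction[OF num den]
    using PQ(5,6) P' Q' by (simp add: quotient[OF E(1)] dpoly_eval_mult dpoly_eval_diff)
qed

end

section \<open>Rescaled derivations\<close>

text \<open>Polynomials over \<open>M\<close> in countably many variables, taken as functions;
  coordinate \<open>k\<close> is the place for the \<open>k\<close>-th derivative of a scaling
  factor. Only values and zeros matter, and linear substitution becomes composition.\<close>

inductive_set polyfun :: "'a::field set \<Rightarrow> ((nat \<Rightarrow> 'a) \<Rightarrow> 'a) set" for M where
  polyfun_const: "c \<in> M \<Longrightarrow> (\<lambda>\<gamma>. c) \<in> polyfun M"
| polyfun_coord: "(\<lambda>\<gamma>. \<gamma> k) \<in> polyfun M"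
| polyfun_add: "f \<in> polyfun M \<Longrightarrow> g \<in> polyfun M \<Longrightarrow> (\<lambda>\<gamma>. f \<gamma> + g \<gamma>) \<in> polyfun M"
| polyfun_mult: "f \<in> polyfun M \<Longrightarrow> g \<in> polyfun M \<Longrightarrow> (\<lambda>\<gamma>. f \<gamma> * g \<gamma>) \<in> polyfun M"

lemma polyfun_mono:
  assumes "f \<in> polyfun M" "M \<subseteq> N"
  shows "f \<in> polyfun N"
  using assms(1)
proof induction
  case (polyfun_const c)
  then show ?case using assms(2) by (intro polyfun.polyfun_const) auto
qed (rule polyfun.intros; assumption)+

lemma polyfun_sum:
  assumes "0 \<in> M" "\<And>i. i \<in> I \<Longrightarrow> f i \<in> polyfun M"
  shows "(\<lambda>\<gamma>. \<Sum>i\<in>I. f i \<gamma>) \<in> polyfun M"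
  using assms(2)
  by (induction I rule: infinite_finite_induct) (simp_all add: assms(1) polyfun_const polyfun_add)

lemma polyfun_power:
  assumes "1 \<in> M" "f \<in> polyfun M"
  shows "(\<lambda>\<gamma>. f \<gamma> ^ m) \<in> polyfun M"
  by (induction m) (simp_all add: assms polyfun_const polyfun_mult)

lemma polyfun_prod:
  assumes "1 \<in> M" "\<And>i. i \<in> I \<Longrightarrow> f i \<in> polyfun M"
  shows "(\<lambda>\<gamma>. \<Prod>i\<in>I. f i \<gamma>) \<in> polyfun M"
  using assms(2)
  by (induction I rule: infinite_finite_induct) (simp_all add: assms(1) polyfun_const polyfun_mult)

lemma polyfun_value:
  assumes "is_subring M" "f \<in> polyfun M" "\<And>k. \<gamma> k \<in> M"
  shows "f \<gamma> \<in> M"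
  using assms(2) by induction (simp_all add: assms(3) subring_add[OF assms(1)] subring_mult[OF assms(1)])

lemma polyfun_finite_support:
  assumes "f \<in> polyfun M"
  shows "\<exists>N. \<forall>\<gamma> \<gamma>'. (\<forall>k<N. \<gamma> k = \<gamma>' k) \<longrightarrow> f \<gamma> = f \<gamma>'"
  using assms
proof induction
  case (polyfun_coord k)
  then show ?case by (intro exI[of _ "Suc k"]) auto
next
  case (polyfun_add f g)
  then obtain N N' where "\<forall>\<gamma> \<gamma>'. (\<forall>k<N. \<gamma> k = \<gamma>' k) \<longrightarrow> f \<gamma> = f \<gamma>'"
    "\<forall>\<gamma> \<gamma>'. (\<forall>k<N'. \<gamma> k = \<gamma>' k) \<longrightarrow> g \<gamma> = g \<gamma>'" by blast
  then have "\<forall>\<gamma> \<gamma>'. (\<forall>k<max N N'. \<gamma> k = \<gamma>' k) \<longrightarrow> f \<gamma> + g \<gamma> = f \<gamma>' + g \<gamma>'"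
    by (metis less_max_iff_disj)
  then show ?case by blast
next
  case (polyfun_mult f g)
  then obtain N N' where "\<forall>\<gamma> \<gamma>'. (\<forall>k<N. \<gamma> k = \<gamma>' k) \<longrightarrow> f \<gamma> = f \<gamma>'"
    "\<forall>\<gamma> \<gamma>'. (\<forall>k<N'. \<gamma> k = \<gamma>' k) \<longrightarrow> g \<gamma> = g \<gamma>'" by blast
  then have "\<forall>\<gamma> \<gamma>'. (\<forall>k<max N N'. \<gamma> k = \<gamma>' k) \<longrightarrow> f \<gamma> * g \<gamma> = f \<gamma>' * g \<gamma>'"
    by (metis less_max_iff_disj)
  then show ?case by blast
qed simp

lemma polyfun_univariate:
  assumes "f \<in> polyfun M"
  shows "\<exists>q. \<forall>s. f (\<gamma>(j := s)) = poly q s"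
  using assms
proof induction
  case (polyfun_const c)
  then show ?case by (intro exI[of _ "[:c:]"]) simp
next
  case (polyfun_coord k)
  then show ?case
    by (cases "k = j") (auto intro: exI[of _ "[:0, 1:]"] exI[of _ "[:\<gamma> k:]"])
next
  case (polyfun_add f g)
  then obtain q q' where "\<forall>s. f (\<gamma>(j := s)) = poly q s" "\<forall>s. g (\<gamma>(j := s)) = poly q' s" by blast
  then show ?case by (intro exI[of _ "q + q'"]) (simp del: fun_upd_apply)
next
  case (polyfun_mult f g)
  then obtain q q' where "\<forall>s. f (\<gamma>(j := s)) = poly q s" "\<forall>s. g (\<gamma>(j := s)) = poly q' s" by blast
  then show ?case by (intro exI[of _ "q * q'"]) (simp del: fun_upd_apply)
qed

text \<open>The coordinates are released from the naturals one by one: in each of them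
  \<open>f\<close> is a univariate polynomial with infinitely many zeros. Since \<open>f\<close>
  sees only finitely many coordinates, the process ends.\<close>

lemma polyfun_zero_if_zero_on_Nats:
  fixes f :: "(nat \<Rightarrow> 'a::field_char_0) \<Rightarrow> 'a"
  assumes f: "f \<in> polyfun M" and zero: "\<And>\<gamma>. (\<And>k. \<gamma> k \<in> \<nat>) \<Longrightarrow> f \<gamma> = 0"
  shows "f \<gamma> = 0"
proof -
  have inf: "infinite (\<nat> :: 'a set)"
    unfolding Nats_def using finite_imageD[of of_nat "UNIV :: nat set"] inj_of_nat infinite_UNIV_nat by blast
  have claim: "f \<gamma> = 0" if "\<And>k. j \<le> k \<Longrightarrow> \<gamma> k \<in> \<nat>" for j \<gamma>
    using that
  proof (induction j arbitrary: \<gamma>)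
    case 0
    then show ?case using zero by simp
  next
    case (Suc j)
    obtain q where q: "\<forall>s. f (\<gamma>(j := s)) = poly q s" using polyfun_univariate[OF f] by blast
    have "poly q s = 0" if "s \<in> \<nat>" for s
    proof -
      have "f (\<gamma>(j := s)) = 0" using Suc.prems that by (intro Suc.IH) auto
      then show ?thesis using q by simp
    qed
    then have "\<nat> \<subseteq> {s. poly q s = 0}" by blast
    then have "q = 0" using inf poly_roots_finite[of q] finite_subset by blast
    then show ?case using q[rule_format, of "\<gamma> j"] by simp
  qed
  obtain N where "\<forall>\<gamma> \<gamma>'. (\<forall>k<N. \<gamma> k = \<gamma>' k) \<longrightarrow> f \<gamma> = f \<gamma>'" using polyfun_finite_support[OF f] by blast
  then have "f \<gamma> = f (\<lambda>k. if k < N then \<gamma> k else 0)" by simp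
  also have "\<dots> = 0" by (rule claim[of N]) auto
  finally show ?thesis .
qed

lemma polyfun_derivation:
  assumes E: "derivation E" and M: "\<And>c. c \<in> M \<Longrightarrow> E c \<in> M" and f: "f \<in> polyfun M"
  shows "\<exists>f'\<in>polyfun M. \<forall>w. E (f (\<lambda>k. (E ^^ k) w)) = f' (\<lambda>k. (E ^^ k) w)"
  using f
proof induction
  case (polyfun_const c)
  then show ?case using M by (intro bexI[of _ "\<lambda>_. E c"]) (auto intro: polyfun.polyfun_const)
next
  case (polyfun_coord k)
  then show ?case by (intro bexI[of _ "\<lambda>\<gamma>. \<gamma> (Suc k)"]) (auto intro: polyfun.polyfun_coord)
next
  case (polyfun_add f g)
  then obtain f' g' where "f' \<in> polyfun M" "g' \<in> polyfun M"
    "\<forall>w. E (f (\<lambda>k. (E ^^ k) w)) = f' (\<lambda>k. (E ^^ k) w)"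
    "\<forall>w. E (g (\<lambda>k. (E ^^ k) w)) = g' (\<lambda>k. (E ^^ k) w)" by blast
  then show ?case
    by (intro bexI[of _ "\<lambda>\<gamma>. f' \<gamma> + g' \<gamma>"]) (simp_all add: derivation_add[OF E] polyfun.polyfun_add)
next
  case (polyfun_mult f g)
  then obtain f' g' where f'g': "f' \<in> polyfun M" "g' \<in> polyfun M"
    "\<forall>w. E (f (\<lambda>k. (E ^^ k) w)) = f' (\<lambda>k. (E ^^ k) w)"
    "\<forall>w. E (g (\<lambda>k. (E ^^ k) w)) = g' (\<lambda>k. (E ^^ k) w)" by blast
  have "(\<lambda>\<gamma>. f' \<gamma> * g \<gamma> + f \<gamma> * g' \<gamma>) \<in> polyfun M"
    by (rule polyfun.polyfun_add[OF polyfun.polyfun_mult polyfun.polyfun_mult];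
        fact f'g' polyfun_mult)
  then show ?case
    by (rule bexI[rotated]) (simp add: f'g' derivation_mult[OF E])
qed

lemma scaled_iter_polyfun:
  assumes E: "derivation E" and M: "\<And>c. c \<in> M \<Longrightarrow> E c \<in> M" and a: "a \<in> M"
  shows "\<exists>f\<in>polyfun M. \<forall>w. ((\<lambda>b. w * E b) ^^ m) a = f (\<lambda>k. (E ^^ k) w)"
proof (induction m)
  case 0
  then show ?case using a by (intro bexI[of _ "\<lambda>_. a"]) (auto intro: polyfun_const)
next
  case (Suc m)
  then obtain f where f: "f \<in> polyfun M" "\<forall>w. ((\<lambda>b. w * E b) ^^ m) a = f (\<lambda>k. (E ^^ k) w)" by blast
  obtain f' where f': "f' \<in> polyfun M" "\<forall>w. E (f (\<lambda>k. (E ^^ k) w)) = f' (\<lambda>k. (E ^^ k) w)"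
    using polyfun_derivation[OF E M f(1)] by blast
  show ?case
    by (rule bexI[OF _ polyfun_mult[OF polyfun_coord[of 0] f'(1)]]) (simp add: f f')
qed

text \<open>\<open>f\<close> is chosen before \<open>w\<close>: one polynomial describes all
  rescalings of \<open>E\<close>, so that an identity known for some factors can be extended to
  others by density.\<close>

lemma scaled_dpoly_polyfun:
  fixes M :: "'a::field set" and u :: "'i \<Rightarrow> 'a"
  assumes E: "derivation E" and M: "is_subring M" "\<And>c. c \<in> M \<Longrightarrow> E c \<in> M"
    and R: "R \<subseteq> M" and u: "\<And>i. u i \<in> M" and A: "A \<in> dpolys R UNIV"
  shows "\<exists>f\<in>polyfun M. \<forall>w. dpoly_eval (\<lambda>b. w * E b) u A = f (\<lambda>k. (E ^^ k) w)"
proof -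
  have "\<forall>v. \<exists>f. f \<in> polyfun M \<and> (\<forall>w. jet (\<lambda>b. w * E b) u v = f (\<lambda>k. (E ^^ k) w))"
    unfolding jet_def using scaled_iter_polyfun[OF E M(2) u] by blast
  then obtain \<theta> where \<theta>: "\<And>v. \<theta> v \<in> polyfun M" "\<And>v w. jet (\<lambda>b. w * E b) u v = \<theta> v (\<lambda>k. (E ^^ k) w)"
    by metis
  define f where "f = (\<lambda>\<gamma>. \<Sum>m\<in>Poly_Mapping.keys A. Poly_Mapping.lookup A m *
    (\<Prod>v\<in>Poly_Mapping.keys m. \<theta> v \<gamma> ^ Poly_Mapping.lookup m v))"
  have "f \<in> polyfun M"
    unfolding f_def
    using A R subring_zero[OF M(1)] subring_one[OF M(1)]
    by (intro polyfun_sum polyfun_mult polyfun_const polyfun_prod polyfun_power \<theta>) (auto simp: dpolys_def)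
  moreover have "dpoly_eval (\<lambda>b. w * E b) u A = f (\<lambda>k. (E ^^ k) w)" for w
    by (simp add: dpoly_eval_eq mpoly_eval_def mono_eval_def f_def \<theta>(2))
  ultimately show ?thesis by blast
qed

lemma polyfun_linear_substitution:
  assumes "f \<in> polyfun M"
  shows "(\<lambda>b. f (\<lambda>k. \<Sum>j<N. b j * V j k)) \<in> polyfun UNIV"
  using assms
proof induction
  case (polyfun_coord k)
  show ?case by (intro polyfun_sum polyfun.polyfun_mult polyfun.polyfun_const polyfun.polyfun_coord) auto
qed (rule polyfun.intros; (assumption | rule UNIV_I))+

section \<open>Density of the jets of rescaling factors\<close>

text \<open>The jets of \<open>p (T - t)\<^sup>j\<close> at \<open>T = t\<close>: they form a triangular system.\<close>

definition centered_jet :: "('a::field \<Rightarrow> 'a) \<Rightarrow> 'a \<Rightarrow> 'a \<Rightarrow> nat \<Rightarrow> nat \<Rightarrow> 'a" where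
  "centered_jet E p t j k = (\<Sum>i\<le>j. of_nat (j choose i) * (- t) ^ (j - i) * (E ^^ k) (t ^ i * p))"

lemma centered_jet_0: "centered_jet E p t j 0 = (if j = 0 then p else 0)"
proof -
  have "centered_jet E p t j 0 = (\<Sum>i\<le>j. of_nat (j choose i) * t ^ i * (- t) ^ (j - i)) * p"
    unfolding centered_jet_def sum_distrib_right by (intro sum.cong) (simp_all add: mult_ac)
  also have "\<dots> = (t + - t) ^ j * p" by (simp only: binomial_ring)
  finally show ?thesis by (simp add: power_0_left)
qed

text \<open>The product rule splits \<open>E\<close> into a part acting on the jets, which gives the
  left-hand side, and a part acting on the powers of \<open>- t\<close>, which binomial absorption
  turns into a multiple of the preceding row.\<close>

lemma centered_jet_Suc:
  assumes E: "derivation E"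
  shows "centered_jet E p t (Suc j) (Suc k) =
    E (centered_jet E p t (Suc j) k) + of_nat (Suc j) * E t * centered_jet E p t j k"
proof -
  let ?X = "\<lambda>i. (E ^^ k) (t ^ i * p)"
  have "E (of_nat (Suc j choose i) * (- t) ^ (Suc j - i) * ?X i) =
      of_nat (Suc j choose i) * (- t) ^ (Suc j - i) * (E ^^ Suc k) (t ^ i * p)
      - of_nat (Suc j) * E t * (of_nat (j choose i) * (- t) ^ (j - i) * ?X i)" if "i \<le> Suc j" for i
  proof -
    have "(of_nat ((Suc j - i) * (Suc j choose i)) :: 'a) = of_nat (Suc j * (j choose i))"
      by (subst binomial_absorb_comp) simp
    then have bin: "of_nat (Suc j choose i) * of_nat (Suc j - i) = (of_nat (Suc j) * of_nat (j choose i) :: 'a)"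
      by (simp only: of_nat_mult mult.commute)
    have "E (of_nat (Suc j choose i) * (- t) ^ (Suc j - i) * ?X i) =
        of_nat (Suc j choose i) * (of_nat (Suc j - i) * (- t) ^ (Suc j - i - 1) * (- E t)) * ?X i
        + of_nat (Suc j choose i) * (- t) ^ (Suc j - i) * E (?X i)"
      using E by (simp only: derivation_mult derivation_power derivation_uminus derivation_of_nat
          mult_zero_left add_0_left)
    also have "of_nat (Suc j choose i) * (of_nat (Suc j - i) * (- t) ^ (Suc j - i - 1) * (- E t)) * ?X i =
        - ((of_nat (Suc j choose i) * of_nat (Suc j - i)) * E t * ((- t) ^ (j - i) * ?X i))"
      by (simp add: mult_ac)
    finally show ?thesis unfolding bin by (simp add: mult_ac)
  qed
  then have "E (centered_jet E p t (Suc j) k) = centered_jet E p t (Suc j) (Suc k)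
      - of_nat (Suc j) * E t * (\<Sum>i\<le>Suc j. of_nat (j choose i) * (- t) ^ (j - i) * ?X i)"
    unfolding centered_jet_def derivation_sum[OF E] sum_distrib_left
    by (simp only: sum_subtractf[symmetric]) (rule sum.cong, auto)
  also have "(\<Sum>i\<le>Suc j. of_nat (j choose i) * (- t) ^ (j - i) * ?X i) = centered_jet E p t j k"
    by (simp add: centered_jet_def binomial_eq_0)
  finally show ?thesis by simp
qed

text \<open>Both terms of the recursion vanish for \<open>j > k\<close>; on the diagonal only the
  second survives, and it contributes one factor \<open>of_nat (Suc k) * E t\<close> per
  step.\<close>

lemma centered_jet_triangular:
  assumes E: "derivation E"
  shows "(\<forall>j>k. centered_jet E p t j k = 0) \<and> centered_jet E p t k k = fact k * E t ^ k * p"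
proof (induction k)
  case 0
  then show ?case by (simp add: centered_jet_0)
next
  case (Suc k)
  have "centered_jet E p t j (Suc k) = 0" if "j > Suc k" for j
  proof (cases j)
    case (Suc j')
    then show ?thesis using that Suc.IH by (simp add: centered_jet_Suc[OF E] derivation_zero[OF E])
  qed (use that in simp)
  moreover have "centered_jet E p t (Suc k) (Suc k) = fact (Suc k) * E t ^ Suc k * p"
    using Suc.IH by (simp add: centered_jet_Suc[OF E] derivation_zero[OF E] mult_ac)
  ultimately show ?case by blast
qed

lemma triangular_solvable:
  fixes W :: "nat \<Rightarrow> nat \<Rightarrow> 'a::field"
  assumes "\<And>j k. k < j \<Longrightarrow> W j k = 0" "\<And>k. W k k \<noteq> 0"
  shows "\<exists>c. \<forall>k<m. (\<Sum>j<m. c j * W j k) = \<gamma> k"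
proof (induction m)
  case (Suc m)
  then obtain c where c: "\<forall>k<m. (\<Sum>j<m. c j * W j k) = \<gamma> k" by blast
  define c' where "c' = c(m := (\<gamma> m - (\<Sum>j<m. c j * W j m)) / W m m)"
  have "(\<Sum>j<m. c' j * W j k) = (\<Sum>j<m. c j * W j k)" for k
    by (intro sum.cong) (auto simp: c'_def)
  then have "(\<Sum>j<Suc m. c' j * W j k) = \<gamma> k" if "k < Suc m" for k
    using that c assms by (cases "k = m") (simp_all add: c'_def)
  then show ?case by blast
qed simp

text \<open>Triangularity solves the system in the centered powers, and the binomial formula
  rewrites the solution in the powers of \<open>t\<close>. The coefficients \<open>b\<close> are
  arbitrary field elements and not constants.\<close>

lemma jets_of_polynomials_span:
  fixes E :: "'a::field_char_0 \<Rightarrow> 'a"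
  assumes E: "derivation E" and t: "E t \<noteq> 0" and p: "p \<noteq> 0"
  shows "\<exists>b. \<forall>k<N. (\<Sum>i<N. b i * (E ^^ k) (t ^ i * p)) = \<gamma> k"
proof -
  let ?W = "centered_jet E p t"
  obtain c where c: "\<forall>k<N. (\<Sum>j<N. c j * ?W j k) = \<gamma> k"
    using triangular_solvable[of ?W N \<gamma>] centered_jet_triangular[OF E, of _ p t] t p by auto
  define b where "b i = (\<Sum>j<N. c j * (of_nat (j choose i) * (- t) ^ (j - i)))" for i
  have W: "?W j k = (\<Sum>i<N. of_nat (j choose i) * (- t) ^ (j - i) * (E ^^ k) (t ^ i * p))"
    if "j < N" for j k
    unfolding centered_jet_def using that by (intro sum.mono_neutral_left) auto
  have "(\<Sum>i<N. b i * (E ^^ k) (t ^ i * p)) = (\<Sum>j<N. c j * ?W j k)" for k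
  proof -
    have "(\<Sum>j<N. c j * ?W j k) =
        (\<Sum>j<N. \<Sum>i<N. c j * (of_nat (j choose i) * (- t) ^ (j - i) * (E ^^ k) (t ^ i * p)))"
      by (intro sum.cong refl) (simp add: W sum_distrib_left)
    also have "\<dots> = (\<Sum>i<N. \<Sum>j<N. c j * (of_nat (j choose i) * (- t) ^ (j - i) * (E ^^ k) (t ^ i * p)))"
      by (rule sum.swap)
    also have "\<dots> = (\<Sum>i<N. b i * (E ^^ k) (t ^ i * p))"
      by (simp add: b_def sum_distrib_right mult.assoc)
    finally show ?thesis by simp
  qed
  then show ?thesis using c by (intro exI[of _ b]) simp
qed

text \<open>\<open>f\<close> is pulled back along the linear map from coefficients \<open>b\<close>
  to jets. At natural \<open>b\<close>, which are constants, the image is a genuine jet and the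
  pullback vanishes; so it vanishes everywhere, and the map reaches every finite part of
  \<open>\<gamma>\<close>.\<close>

lemma polyfun_zero_if_zero_on_jets:
  fixes E :: "'a::field_char_0 \<Rightarrow> 'a"
  assumes E: "derivation E" and t: "E t \<noteq> 0" and p: "p \<noteq> 0" and f: "f \<in> polyfun UNIV"
    and zero: "\<And>b N. f (\<lambda>k. (E ^^ k) ((\<Sum>i<N. of_nat (b i) * t ^ i) * p)) = 0"
  shows "f \<gamma> = 0"
proof -
  obtain N where N: "\<forall>\<gamma> \<gamma>'. (\<forall>k<N. \<gamma> k = \<gamma>' k) \<longrightarrow> f \<gamma> = f \<gamma>'" using polyfun_finite_support[OF f] by blast
  obtain b where b: "\<forall>k<N. (\<Sum>i<N. b i * (E ^^ k) (t ^ i * p)) = \<gamma> k"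
    using jets_of_polynomials_span[OF E t p] by blast
  let ?g = "\<lambda>b. f (\<lambda>k. \<Sum>i<N. b i * (E ^^ k) (t ^ i * p))"
  have "?g b = 0"
  proof (rule polyfun_zero_if_zero_on_Nats[OF polyfun_linear_substitution[OF f, of "\<lambda>i k. (E ^^ k) (t ^ i * p)" N]])
    fix b :: "nat \<Rightarrow> 'a" assume "\<And>k. b k \<in> \<nat>"
    then have "\<forall>k. \<exists>m. b k = of_nat m" by (auto elim: Nats_cases)
    then obtain c where c: "\<And>k. b k = of_nat (c k)" by metis
    have "(\<Sum>i<N. b i * (E ^^ k) (t ^ i * p)) = (E ^^ k) ((\<Sum>i<N. of_nat (c i) * t ^ i) * p)" for k
      using E by (simp add: c sum_distrib_right derivation_iter_sum mult.assoc derivation_iter_const_mult)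
    then show "?g b = 0" using zero by simp
  qed
  moreover have "f \<gamma> = ?g b" using N b by simp
  ultimately show ?thesis by simp
qed

section \<open>Change of derivation and of indeterminates\<close>

lemma der_closure_jets_step:
  assumes "derivation E" "\<And>c. c \<in> k \<Longrightarrow> E c \<in> k" "b \<in> der_closure k (jets E u I m)"
  shows "E b \<in> der_closure k (jets E u I (Suc m))"
  using der_closure_jets_iter[OF assms, of 1] by simp

lemma der_closure_jets_mono: "l \<le> m \<Longrightarrow> der_closure k (jets E u I l) \<subseteq> der_closure k (jets E u I m)"
  by (intro der_closure_mono jets_mono) auto

lemma diff_independent_transfer:
  fixes d E :: "'a::field_char_0 \<Rightarrow> 'a" and u v :: "'i::finite \<Rightarrow> 'a"
  assumes F: "is_subring F" and E: "derivation E" "\<And>c. c \<in> F \<Longrightarrow> E c \<in> F"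
    and g: "g \<in> F" "\<And>a. d a = g * E a"
    and uv: "\<And>i. u i \<in> der_closure F (range v)" and u: "diff_alg_independent d F u UNIV"
  shows "diff_alg_independent E F v UNIV"
proof (rule ccontr)
  assume dep: "\<not> ?thesis"
  obtain J a where J: "finite J" "J \<subseteq> UNIV \<times> UNIV" "\<exists>w\<in>J. a w \<noteq> 0"
    "\<And>D. derivation D \<Longrightarrow> \<forall>c\<in>F. D c = 0 \<Longrightarrow> (\<Sum>w\<in>J. a w * D (jet E v w)) = 0"
    using linear_relation_of_diff_dependent[OF F dep] by blast
  then obtain w0 where w0: "w0 \<in> J" "a w0 \<noteq> 0" by blast
  define m where "m = Suc (Max (snd ` J))"
  have less_m: "snd w < m" if "w \<in> J" for w
    unfolding m_def less_Suc_eq_le using J(1) that by simp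
  let ?B = "jet E v ` (UNIV \<times> {..<m} - {w0})"
  have w0B: "jet E v w0 \<in> der_closure F ?B"
  proof (rule der_closure_of_linear_relation[where J = J, OF J(1) w0 J(4)])
    fix w assume "w \<in> J" "w \<noteq> w0"
    then have "w \<in> UNIV \<times> {..<m} - {w0}" using less_m[of w] by (cases w) auto
    then show "jet E v w \<in> ?B" by (rule imageI)
  qed
  have "jets E v UNIV m \<subseteq> der_closure F ?B"
  proof
    fix b assume "b \<in> jets E v UNIV m"
    then obtain w where w: "w \<in> UNIV \<times> {..<m}" "b = jet E v w" unfolding jets_def by (rule imageE)
    show "b \<in> der_closure F ?B"
    proof (cases "w = w0")
      case False
      then have "b \<in> ?B" using w by blast
      then show ?thesis by (rule subsetD[OF der_closure_incl])
    qed (use w w0B in simp)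
  qed
  moreover have closure: "(d ^^ j) (u i) \<in> der_closure F (jets E v UNIV (Suc j))" for i j
  proof (induction j)
    case 0
    have "range v \<subseteq> jets E v UNIV (Suc 0)" using jetsI[of _ UNIV 0 "Suc 0" E v] by auto
    then show ?case using uv[of i] der_closure_mono[of "range v"] by auto
  next
    case (Suc j)
    have "E ((d ^^ j) (u i)) \<in> der_closure F (jets E v UNIV (Suc (Suc j)))"
      by (rule der_closure_jets_step[OF E Suc])
    moreover have "g \<in> der_closure F (jets E v UNIV (Suc (Suc j)))" using g(1) der_closure_base by blast
    ultimately show ?case 
      by (simp add: g(2)[of "(d ^^ j) (u i)"] subring_mult[OF is_subring_der_closure])
  qed
  have "jets d u UNIV m \<subseteq> der_closure F (jets E v UNIV m)"
  proof
    fix b assume "b \<in> jets d u UNIV m"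
    then obtain i j where "j < m" "b = (d ^^ j) (u i)" by (rule jetsE)
    then show "b \<in> der_closure F (jets E v UNIV m)"
      using closure[of j i] der_closure_jets_mono[of "Suc j" m F E v UNIV] by auto
  qed
  ultimately have "jets d u UNIV m \<subseteq> der_closure F ?B" using der_closure_trans by blast
  then have "CARD('i) * m \<le> card ?B" by (intro diff_independent_card_le[OF F u]) auto
  also have "\<dots> \<le> card (UNIV \<times> {..<m} - {w0} :: ('i \<times> nat) set)" by (intro card_image_le) auto
  also have "\<dots> < card (UNIV \<times> {..<m} :: ('i \<times> nat) set)"
    using less_m[OF w0(1)] by (intro card_Diff1_less) (simp_all add: mem_Times_iff)
  finally show False by (simp add: card_cartesian_product)
qed

section \<open>Invariant differential rational functions\<close>

locale relative_invariant =
  fixes d :: "'a::field_char_0 \<Rightarrow> 'a" and F :: "'a set" and x :: "'a^'n"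
    and H :: "(('a^'n^'n) \<times> ('a^'n)) set" and p :: 'a
  assumes d: "derivation d"
    and F: "differential_subfield d F"
    and nonconst: "constants d F \<noteq> F"
    and x: "diff_alg_independent d F (($) x) UNIV"
    and H: "subgroup H (affine_group (constants d F))"
    and p_in_L: "p \<in> diff_rat_functions d (constants d F) x"
    and p_nonzero: "p \<noteq> 0"
    and p_relative: "\<forall>g \<in> F - {0}. \<forall>(h, h0) \<in> H.
      diff_subst d (constants d F) x (scale_der g d) (h *v x + h0) p = inverse g * p"
begin

abbreviation "C \<equiv> constants d F"
abbreviation "\<delta> \<equiv> scale_der p d"
abbreviation "L \<equiv> diff_rat_functions d C x"
abbreviation "K \<equiv> diff_invariants d F H x"
abbreviation "\<tau> g h h0 \<equiv> diff_subst d C x (scale_der g d) (h *v x + h0)"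

lemma subring_F: "is_subring F"
  using F by (simp add: differential_subfield_def is_subring_def)

lemma inverse_F: "a \<in> F \<Longrightarrow> inverse a \<in> F" and d_F: "a \<in> F \<Longrightarrow> d a \<in> F"
  using F by (simp_all add: differential_subfield_def)

lemma C_F: "C \<subseteq> F" and d_C: "c \<in> C \<Longrightarrow> d c = 0" and zero_C: "0 \<in> C"
  using subring_zero[OF subring_F] d by (auto simp: constants_def)

lemma subfield_C: "is_subfield C"
proof -
  have "d (inverse a) = 0" if "d a = 0" for a
    using that d by (cases "a = 0") (auto simp: derivation_inverse)
  then show ?thesis
    using subring_F inverse_F d
    by (auto simp: is_subfield_def is_subring_def constants_def derivation_diff derivation_mult)
qed

lemma subring_C: "is_subring C"
  using subfield_C is_subfield_def by blast

lemma derivation_\<delta>: "derivation \<delta>"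
  by (rule derivation_scale_der[OF d])

lemma \<delta>_C: "c \<in> C \<Longrightarrow> \<delta> c = 0" and \<delta>_C_closed: "c \<in> C \<Longrightarrow> \<delta> c \<in> C"
  using d_C zero_C by (auto simp: scale_der_def)

lemma d_eq_\<delta>: "d a = p * \<delta> a"
  using p_nonzero by (simp add: scale_der_def)

lemma x_independent_C: "diff_alg_independent d C (($) x) UNIV"
proof -
  have "dpolys C UNIV \<subseteq> dpolys F (UNIV :: 'n set)"
    unfolding dpolys_eq using C_F by (intro mpolys_mono) auto
  then show ?thesis using x unfolding diff_alg_independent_def by blast
qed

lemma H_inverse:
  assumes "(h, h0) \<in> H"
  shows "\<exists>k. (\<forall>i j. k $ i $ j \<in> C) \<and> k ** h = mat 1"
    and H_entry_matrix: "h $ i $ j \<in> C" and H_entry_vector: "h0 $ i \<in> C"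
proof -
  have "(h, h0) \<in> carrier (affine_group C)" using subgroup.subset[OF H] assms by blast
  then show "\<exists>k. (\<forall>i j. k $ i $ j \<in> C) \<and> k ** h = mat 1" "h $ i $ j \<in> C" "h0 $ i \<in> C"
    by (auto simp: affine_group_def GL_def matrices_over_def)
qed

lemma H_one: "(mat 1, 0) \<in> H"
  using subgroup.one_closed[OF H] by (simp add: affine_group_def)

text \<open>\<open>x\<close> is recovered as \<open>k *v (y - h0)\<close> with \<open>k\<close> the
  inverse of \<open>h\<close>. Independence is transferred over \<open>F\<close>, because
  \<open>g\<close> lies there and not in \<open>C\<close>, and is then restricted to
  \<open>C\<close>.\<close>

lemma diff_substitution_H:
  assumes g: "g \<in> F - {0}" and h: "(h, h0) \<in> H"
  shows "diff_substitution d (scale_der g d) C x (h *v x + h0)"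
proof
  let ?y = "h *v x + h0"
  show "diff_alg_independent (scale_der g d) C (($) ?y) UNIV"
  proof -
    obtain k where k: "\<forall>i j. k $ i $ j \<in> C" "k ** h = mat 1"
      using H_inverse[OF h] by (elim exE conjE)
    have "k *v (?y - h0) = x" using k(2) by (simp add: matrix_vector_mul_assoc)
    moreover have "(k *v (?y - h0)) $ i = (\<Sum>j\<in>UNIV. k $ i $ j * (?y $ j - h0 $ j))" for i
      unfolding matrix_vector_mult_def[of k] by (simp only: vec_lambda_beta vector_minus_component)
    ultimately have xk: "x $ i = (\<Sum>j\<in>UNIV. k $ i $ j * (?y $ j - h0 $ j))" for i by metis
    have "x $ i \<in> der_closure F (range (($) ?y))" for i
      unfolding xk
    proof (intro subring_sum subring_mult subring_diff is_subring_der_closure)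
      fix j
      show "k $ i $ j \<in> der_closure F (range (($) ?y))" "h0 $ j \<in> der_closure F (range (($) ?y))"
        
        using k(1) H_entry_vector[OF h] C_F der_closure_base[of F] by blast+
      show "?y $ j \<in> der_closure F (range (($) ?y))" using der_closure_incl by blast
    qed
    moreover have "scale_der g d c \<in> F" if "c \<in> F" for c
      using g that by (auto simp: scale_der_def intro!: subring_mult[OF subring_F] inverse_F d_F)
    moreover have "d a = g * scale_der g d a" for a using g by (simp add: scale_der_def)
    ultimately have ind: "diff_alg_independent (scale_der g d) F (($) ?y) UNIV"
      using g by (intro diff_independent_transfer[OF subring_F derivation_scale_der[OF d] _ _ _ _ x]) auto
    have "dpolys C UNIV \<subseteq> dpolys F (UNIV :: 'n set)"
      unfolding dpolys_eq using C_F by (intro mpolys_mono) auto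
    then show ?thesis using ind unfolding diff_alg_independent_def by blast
  qed
qed (simp_all add: subfield_C d d_C derivation_scale_der[OF d] x_independent_C, simp add: scale_der_def d_C)

lemma diff_substitution_id:
  assumes "g \<in> F - {0}"
  shows "diff_substitution d (scale_der g d) C x x"
  using diff_substitution_H[OF assms H_one] by simp

lemma one_F: "1 \<in> F - {0}"
  using subring_one[OF subring_F] by simp

text \<open>The filtration by order of the algebraic closure of the field generated by
  \<open>x\<close> and its \<delta>-derivatives over \<open>C\<close>. The index is kept because the
  growth estimate needs the order at which an invariant appears.\<close>

definition Z :: "nat \<Rightarrow> 'a set" where
  "Z r = der_closure C (jets \<delta> (($) x) UNIV r)"

definition M :: "'a set" where
  "M = (\<Union>r. Z r)"

lemma Z_mono: "r \<le> s \<Longrightarrow> Z r \<subseteq> Z s"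
  unfolding Z_def by (rule der_closure_jets_mono)

lemma subring_M: "is_subring M" and inverse_M: "a \<in> M \<Longrightarrow> inverse a \<in> M"
proof -
  have sub: "is_subfield (Z r)" for r unfolding Z_def by (rule is_subfield_der_closure)
  then have sub': "is_subring (Z r)" for r using is_subfield_def by blast
  have "a - b \<in> M \<and> a * b \<in> M" if ab: "a \<in> M" "b \<in> M" for a b
  proof -
    obtain r s where "a \<in> Z r" "b \<in> Z s" using ab unfolding M_def by blast
    then have "a \<in> Z (max r s)" "b \<in> Z (max r s)" 
      using Z_mono[of r "max r s"] Z_mono[of s "max r s"] by auto
    then have "a - b \<in> Z (max r s)" "a * b \<in> Z (max r s)"
      by (simp_all add: subring_diff[OF sub'] subring_mult[OF sub'])
    then show ?thesis unfolding M_def by blast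
  qed
  moreover have "0 \<in> M" "1 \<in> M" using subring_zero[OF sub'] subring_one[OF sub'] unfolding M_def by auto
  ultimately show "is_subring M" by (simp add: is_subring_def)
  show "inverse a \<in> M" if "a \<in> M" using that sub unfolding M_def is_subfield_def by blast
qed

lemma \<delta>_M: "a \<in> M \<Longrightarrow> \<delta> a \<in> M"
  unfolding M_def Z_def using der_closure_jets_step[OF derivation_\<delta> \<delta>_C_closed] by blast

lemma C_M: "C \<subseteq> M"
  unfolding M_def Z_def using der_closure_base by blast

lemma x_M: "x $ i \<in> M"
proof -
  have "x $ i \<in> jets \<delta> (($) x) UNIV 1" using jetsI[of i UNIV 0 1 \<delta> "($) x"] by simp
  then show ?thesis unfolding M_def Z_def using der_closure_incl by blast
qed

section \<open>Formal rescaling and the upper bound\<close>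

lemma scaled_polyfun:
  assumes "A \<in> dpolys C UNIV"
  obtains f where "f \<in> polyfun M" "\<And>w. dpoly_eval (\<lambda>b. w * \<delta> b) (($) x) A = f (\<lambda>k. (\<delta> ^^ k) w)"
proof -
  have "\<exists>f\<in>polyfun M. \<forall>w. dpoly_eval (\<lambda>b. w * \<delta> b) (($) x) A = f (\<lambda>k. (\<delta> ^^ k) w)"
    by (rule scaled_dpoly_polyfun[OF derivation_\<delta> subring_M _ C_M x_M assms]) (rule \<delta>_M)
  then show thesis using that by blast
qed

lemma scale_der_inverse: "u \<noteq> 0 \<Longrightarrow> scale_der (inverse u) d = (\<lambda>b. u * p * \<delta> b)"
  using p_nonzero by (auto simp: scale_der_def fun_eq_iff)

text \<open>The density statement also tests the factor \<open>u = 0\<close>, where nothing is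
  known; multiplying \<open>f\<close> by coordinate \<open>0\<close> makes the product vanish there.
  The element \<open>t\<close> is a nonconstant of \<open>F\<close>.\<close>

lemma polyfun_zero_off_zero:
  assumes f: "f \<in> polyfun UNIV" and zero: "\<And>u. u \<in> F - {0} \<Longrightarrow> f (\<lambda>k. (\<delta> ^^ k) (u * p)) = 0"
    and \<gamma>: "\<gamma> 0 \<noteq> 0"
  shows "f \<gamma> = 0"
proof -
  obtain t where t: "t \<in> F" "d t \<noteq> 0" using nonconst by (auto simp: constants_def)
  have "(\<lambda>\<gamma>. \<gamma> 0 * f \<gamma>) \<gamma> = 0"
  proof (rule polyfun_zero_if_zero_on_jets[OF derivation_\<delta> _ p_nonzero polyfun_mult[OF polyfun_coord f]])
    show "\<delta> t \<noteq> 0" using t p_nonzero by (simp add: scale_der_def)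
    fix b :: "nat \<Rightarrow> nat" and N
    let ?u = "\<Sum>i<N. of_nat (b i) * t ^ i"
    have "?u \<in> F"
      using t(1) by (intro subring_sum subring_mult subring_of_nat subring_power subring_F)
    then show "(\<delta> ^^ 0) (?u * p) * f (\<lambda>k. (\<delta> ^^ k) (?u * p)) = 0"
      using zero[of ?u] by (cases "?u = 0") auto
  qed
  then show ?thesis using \<gamma> by simp
qed

text \<open>Invariance under \<open>g = u\<^sup>-\<^sup>1\<close> for all \<open>u \<in> F\<^sup>*\<close> extends, by Zariski density of the jets of
  \<open>u p\<close>, to formal rescalings of \<open>\<delta>\<close>, so that \<open>f\<close> can be written with \<open>\<delta>\<close> in place of \<open>d\<close>.\<close>

lemma invariants_in_M: "K \<subseteq> M"
proof
  fix f assume f: "f \<in> K"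
  then obtain A B where AB: "A \<in> dpolys C UNIV" "B \<in> dpolys C UNIV" "dpoly_eval d (($) x) B \<noteq> 0"
    "f = dpoly_eval d (($) x) A / dpoly_eval d (($) x) B"
    unfolding diff_invariants_def diff_rat_functions_def by blast
  have inv: "\<tau> g (mat 1) 0 f = f" if "g \<in> F - {0}" for g
    using f that H_one unfolding diff_invariants_def by fastforce
  obtain fA where fA: "fA \<in> polyfun M" "\<And>w. dpoly_eval (\<lambda>b. w * \<delta> b) (($) x) A = fA (\<lambda>k. (\<delta> ^^ k) w)"
    using scaled_polyfun[OF AB(1)] by blast
  obtain fB where fB: "fB \<in> polyfun M" "\<And>w. dpoly_eval (\<lambda>b. w * \<delta> b) (($) x) B = fB (\<lambda>k. (\<delta> ^^ k) w)"
    using scaled_polyfun[OF AB(2)] by blast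
  \<comment> \<open>Invariance under \<open>g = inverse u\<close> says that \<open>A - f * B\<close>
    vanishes for the scaling factor \<open>u * p\<close>. Here \<open>f\<close> is a coefficient not
    yet known to lie in \<open>M\<close>.\<close>
  have \<Phi>: "fA \<gamma> + (- f) * fB \<gamma> = 0" if "\<gamma> 0 \<noteq> 0" for \<gamma>
  proof (rule polyfun_zero_off_zero[where \<gamma> = \<gamma>, OF _ _ that])
    show "(\<lambda>\<gamma>. fA \<gamma> + (- f) * fB \<gamma>) \<in> polyfun UNIV"
      by (intro polyfun_add polyfun_mult polyfun_const UNIV_I polyfun_mono[OF fA(1)] polyfun_mono[OF fB(1)] subset_UNIV)
    fix u assume u: "u \<in> F - {0}"
    then have g: "inverse u \<in> F - {0}" using inverse_F by auto
    interpret S: diff_substitution d "scale_der (inverse u) d" C x x by (rule diff_substitution_id[OF g])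
    have "S.\<sigma> f = f" using inv[OF g] by simp
    then have "S.ey A / S.ey B = f" using S.subst_fraction[OF AB(1-3)] AB(4) by simp
    then have "S.ey A = f * S.ey B" using S.eval_nonzero[OF AB(2,3)] by (simp add: field_simps)
    then show "fA (\<lambda>k. (\<delta> ^^ k) (u * p)) + (- f) * fB (\<lambda>k. (\<delta> ^^ k) (u * p)) = 0"
      using u by (simp add: scale_der_inverse flip: fA(2) fB(2))
  qed
  \<comment> \<open>A point is needed where the denominator survives and whose coordinates lie in
    \<open>M\<close>. The jet of \<open>p\<close> gives back \<open>d\<close>, where
    \<open>B\<close> is nonzero, so \<open>fB\<close> cannot vanish at all natural points.\<close>
  have "\<exists>\<gamma>. (\<forall>k. \<gamma> k \<in> \<nat>) \<and> \<gamma> 0 * fB \<gamma> \<noteq> 0"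
  proof (rule ccontr)
    assume none: "\<not> ?thesis"
    have "(\<lambda>\<gamma>. \<gamma> 0 * fB \<gamma>) (\<lambda>k. (\<delta> ^^ k) p) = 0"
    proof (rule polyfun_zero_if_zero_on_Nats[OF polyfun_mult[OF polyfun_coord fB(1)]])
      fix \<gamma> :: "nat \<Rightarrow> 'a" assume "\<And>k. \<gamma> k \<in> \<nat>"
      then have "\<forall>k. \<gamma> k \<in> \<nat>" by simp
      then show "\<gamma> 0 * fB \<gamma> = 0" using none by blast
    qed
    then have "fB (\<lambda>k. (\<delta> ^^ k) p) = 0" using p_nonzero by simp
    moreover have "(\<lambda>b. p * \<delta> b) = d" by (simp add: d_eq_\<delta> fun_eq_iff)
    ultimately show False using fB(2)[of p] AB(3) by simp
  qed
  then obtain \<gamma> where \<gamma>: "\<And>k. \<gamma> k \<in> \<nat>" "\<gamma> 0 \<noteq> 0" "fB \<gamma> \<noteq> 0" by auto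
  have "\<gamma> k \<in> M" for k using \<gamma>(1)[of k] by (auto elim: Nats_cases simp: subring_of_nat[OF subring_M])
  then have "fA \<gamma> \<in> M" "fB \<gamma> \<in> M"
    using polyfun_value[OF subring_M fA(1)] polyfun_value[OF subring_M fB(1)] by auto
  moreover have "f = fA \<gamma> * inverse (fB \<gamma>)" using \<Phi>[of \<gamma>] \<gamma>(2,3) by (simp add: field_simps)
  ultimately show "f \<in> M" using subring_mult[OF subring_M] inverse_M by simp
qed

text \<open>Rescaling formally by \<open>w = 1\<close> turns the relative invariance of \<open>p = P / Q\<close> into the
  \<open>\<delta>\<close>-relation \<open>P = Q\<close> for \<open>x\<close>.\<close>

lemma x_\<delta>_dependent: "\<not> diff_alg_independent \<delta> C (($) x) UNIV"
proof
  assume ind: "diff_alg_independent \<delta> C (($) x) UNIV"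
  obtain P Q where PQ: "P \<in> dpolys C UNIV" "Q \<in> dpolys C UNIV" "dpoly_eval d (($) x) Q \<noteq> 0"
    "p = dpoly_eval d (($) x) P / dpoly_eval d (($) x) Q"
    using p_in_L unfolding diff_rat_functions_def by blast
  have inv: "\<tau> g (mat 1) 0 p = inverse g * p" if "g \<in> F - {0}" for g
    using p_relative that H_one by fastforce
  obtain fP where fP: "fP \<in> polyfun M" "\<And>w. dpoly_eval (\<lambda>b. w * \<delta> b) (($) x) P = fP (\<lambda>k. (\<delta> ^^ k) w)"
    using scaled_polyfun[OF PQ(1)] by blast
  obtain fQ where fQ: "fQ \<in> polyfun M" "\<And>w. dpoly_eval (\<lambda>b. w * \<delta> b) (($) x) Q = fQ (\<lambda>k. (\<delta> ^^ k) w)"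
    using scaled_polyfun[OF PQ(2)] by blast
  \<comment> \<open>The jet of the scaling factor \<open>1\<close>, for which the rescaled
    derivation is \<delta> itself.\<close>
  let ?\<gamma> = "\<lambda>k. (\<delta> ^^ k) 1"
  have "fP ?\<gamma> + (- 1) * (?\<gamma> 0 * fQ ?\<gamma>) = 0"
  proof (rule polyfun_zero_off_zero[where \<gamma> = ?\<gamma>])
    show "(\<lambda>\<gamma>. fP \<gamma> + (- 1) * (\<gamma> 0 * fQ \<gamma>)) \<in> polyfun UNIV"
      by (intro polyfun_add polyfun_mult polyfun_const polyfun_coord UNIV_I
          polyfun_mono[OF fP(1)] polyfun_mono[OF fQ(1)] subset_UNIV)
    fix u assume u: "u \<in> F - {0}"
    then have g: "inverse u \<in> F - {0}" using inverse_F by auto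
    interpret S: diff_substitution d "scale_der (inverse u) d" C x x by (rule diff_substitution_id[OF g])
    have "S.\<sigma> p = u * p" using inv[OF g] by simp
    then have "S.ey P / S.ey Q = u * p" using S.subst_fraction[OF PQ(1-3)] PQ(4) by simp
    then have "S.ey P = u * p * S.ey Q" using S.eval_nonzero[OF PQ(2,3)] by (simp add: field_simps)
    then show "fP (\<lambda>k. (\<delta> ^^ k) (u * p)) + (- 1) * ((\<delta> ^^ 0) (u * p) * fQ (\<lambda>k. (\<delta> ^^ k) (u * p))) = 0"
      using u by (simp add: scale_der_inverse flip: fP(2) fQ(2))
  qed simp
  then have "dpoly_eval \<delta> (($) x) P = dpoly_eval \<delta> (($) x) Q"
    using fP(2)[of 1] fQ(2)[of 1] by simp
  then have "dpoly_eval \<delta> (($) x) (P - Q) = 0" by (simp add: dpoly_eval_diff)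
  then have "P - Q = 0"
    using ind dpolys_diff[OF subring_C PQ(1,2)] unfolding diff_alg_independent_def by blast
  \<comment> \<open>Equality of \<open>P\<close> and \<open>Q\<close> as formal polynomials would
    make \<open>p\<close> a constant, which substitution fixes; rescaling with \<open>g = 2\<close>
    then contradicts relative invariance.\<close>
  then have p1: "p = 1" using PQ(3,4) by simp
  have two: "2 \<in> F - {0}" using subring_of_nat[OF subring_F, of 2] by simp
  interpret S: diff_substitution d "scale_der 2 d" C x x by (rule diff_substitution_id[OF two])
  have "S.\<sigma> 1 = 1" by (rule S.subst_const[OF subring_one[OF subring_C]])
  then show False using inv[OF two] p1 by simp
qed

text \<open>By the dependence of \<open>x\<close> one coordinate \<open>x $ i\<close> contributes
  only boundedly many jets, so the \<delta>-jets of \<open>x\<close> grow with slope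
  \<open>CARD('n) - 1\<close>. Those of \<open>S\<close> are algebraic over them after a fixed shift
  of order.\<close>

lemma independent_invariants_card:
  assumes S: "S \<subseteq> K" "diff_alg_independent \<delta> C id S" "finite S"
  shows "card S < CARD('n)"
proof -
  obtain i r where i: "(\<delta> ^^ r) (x $ i) \<in>
      der_closure C (jets \<delta> (($) x) (UNIV - {i}) (Suc r) \<union> jets \<delta> id {x $ i} r)"
    using diff_dependent_top_jet[OF subring_C x_\<delta>_dependent] by blast
  define B where "B k = jets \<delta> (($) x) (UNIV - {i}) (Suc r + k) \<union> jets \<delta> id {x $ i} r" for k
  have B_mono: "B j \<subseteq> B k" if "j \<le> k" for j k
    unfolding B_def using that by (intro Un_mono jets_mono) auto
  have tail: "jets \<delta> (($) x) UNIV k \<subseteq> der_closure C (B k)" for k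
  proof
    fix b assume "b \<in> jets \<delta> (($) x) UNIV k"
    then obtain i' j where j: "j < k" "b = (\<delta> ^^ j) (x $ i')" by (rule jetsE)
    show "b \<in> der_closure C (B k)"
    proof (cases "i' = i")
      case True
      have "b \<in> der_closure C (B j)"
        unfolding B_def j(2) True by (rule der_closure_jets_tail[OF derivation_\<delta> \<delta>_C_closed i])
      then show ?thesis using der_closure_mono[OF B_mono[of j k]] j(1) by auto
    next
      case False
      then have "b \<in> B k" using j jetsI[of i' "UNIV - {i}" j "Suc r + k" \<delta> "($) x"] by (simp add: B_def)
      then show ?thesis by (rule subsetD[OF der_closure_incl])
    qed
  qed
  have finB: "finite (B k)" for k unfolding B_def by (simp add: finite_jets)
  have cardB: "card (B k) \<le> (CARD('n) - 1) * (Suc r + k) + r" for k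
  proof -
    have "card (jets \<delta> (($) x) (UNIV - {i}) (Suc r + k)) \<le> (CARD('n) - 1) * (Suc r + k)"
      using card_jets_le[of "UNIV - {i}" \<delta> "($) x" "Suc r + k"] by (simp add: card_Diff_singleton)
    moreover have "card (jets \<delta> id {x $ i} r) \<le> r" using card_jets_le[of "{x $ i}" \<delta> id r] by simp
    ultimately show ?thesis unfolding B_def using card_Un_le order.trans add_mono by meson
  qed
  \<comment> \<open>Finiteness of \<open>S\<close> gives one order \<open>c\<close> for all its
    elements.\<close>
  have "\<exists>c. S \<subseteq> Z c"
    using S(3) S(1)
  proof (induction S rule: finite_induct)
    case (insert s S)
    then obtain c where c: "S \<subseteq> Z c" by auto
    obtain c' where c': "s \<in> Z c'" using insert.prems invariants_in_M unfolding M_def by blast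
    have "insert s S \<subseteq> Z (max c c')" using c c' Z_mono[of c "max c c'"] Z_mono[of c' "max c c'"] by auto
    then show ?case by blast
  qed simp
  then obtain c where c: "S \<subseteq> Z c" by blast
  have bound: "card S * k \<le> (CARD('n) - 1) * (Suc r + (c + k)) + r" for k
  proof -
    have "jets \<delta> id S k \<subseteq> der_closure C (jets \<delta> (($) x) UNIV (c + k))"
    proof
      fix b assume "b \<in> jets \<delta> id S k"
      then obtain s j where s: "s \<in> S" "j < k" "b = (\<delta> ^^ j) (id s)" by (rule jetsE)
      then have "b \<in> der_closure C (jets \<delta> (($) x) UNIV (c + j))"
        by (auto intro!: der_closure_jets_iter[OF derivation_\<delta>] \<delta>_C_closed dest!: subsetD[OF c[unfolded Z_def]])
      then show "b \<in> der_closure C (jets \<delta> (($) x) UNIV (c + k))"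
        using s(2) der_closure_jets_mono[of "c + j" "c + k" C \<delta> "($) x" UNIV] by auto
    qed
    then have "jets \<delta> id S k \<subseteq> der_closure C (B (c + k))"
      using tail[of "c + k"] der_closure_trans by blast
    then have "card S * k \<le> card (B (c + k))"
      by (rule diff_independent_card_le[OF subring_C S(2,3) finB])
    then show ?thesis using cardB[of "c + k"] by simp
  qed
  show ?thesis
  proof (rule ccontr)
    assume ge: "\<not> ?thesis"
    define m where "m = CARD('n) - 1"
    \<comment> \<open>The part of the bound that does not depend on \<open>k\<close>; at
      \<open>k = Suc a\<close> an excess of one in the slope already outweighs it.\<close>
    define a where "a = m * (Suc r + c) + r"
    have "Suc m \<le> card S" using ge unfolding m_def by simp
    then have "Suc m * Suc a \<le> card S * Suc a" by (rule mult_le_mono1)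
    also have "\<dots> \<le> m * (Suc r + (c + Suc a)) + r" using bound[of "Suc a"] by (simp add: m_def)
    also have "\<dots> = m * Suc a + a" by (simp add: a_def algebra_simps)
    finally show False by simp
  qed
qed

section \<open>The invariant linear equation and the lower bound\<close>

lemma subfield_L: "is_subfield L" and d_L: "a \<in> L \<Longrightarrow> d a \<in> L" and x_L: "x $ i \<in> L"
proof -
  interpret S: diff_substitution d "scale_der 1 d" C x x by (rule diff_substitution_id[OF one_F])
  show "is_subfield L" by (rule S.is_subfield_L)
  show "d a \<in> L" if "a \<in> L" by (rule S.deriv_L[OF that])
  show "x $ i \<in> L" by (rule S.var_in_L)
qed

lemma subring_L: "is_subring L"
  using subfield_L is_subfield_def by blast

lemma inverse_p_L: "inverse p \<in> L"
  using subfield_L p_in_L is_subfield_def by blast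

lemma \<delta>_L: "a \<in> L \<Longrightarrow> \<delta> a \<in> L"
  by (simp add: scale_der_def subring_mult[OF subring_L] inverse_p_L d_L)

lemma \<delta>_iter_x_L: "(\<delta> ^^ k) (x $ i) \<in> L"
  by (induction k) (simp_all add: x_L \<delta>_L)

text \<open>The substitutions commute with \<open>\<delta>\<close> because \<open>p\<close> and \<open>d\<close> are both scaled by \<open>g\<^sup>-\<^sup>1\<close>.\<close>

lemma subst_\<delta>_iter_x:
  assumes g: "g \<in> F - {0}" and h: "(h, h0) \<in> H"
  shows "\<tau> g h h0 ((\<delta> ^^ Suc k) (x $ i)) = (\<Sum>j\<in>UNIV. h $ i $ j * (\<delta> ^^ Suc k) (x $ j))"
proof -
  interpret S: diff_substitution d "scale_der g d" C x "h *v x + h0" by (rule diff_substitution_H[OF g h])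
  have p: "S.\<sigma> p = inverse g * p" using p_relative g h by blast
  have \<sigma>\<delta>: "S.\<sigma> (\<delta> a) = \<delta> (S.\<sigma> a)" if "a \<in> L" for a
  proof -
    have "S.\<sigma> (\<delta> a) = inverse (inverse g * p) * (inverse g * d (S.\<sigma> a))"
      using that by (simp add: scale_der_def[of p] S.subst_mult[OF inverse_p_L d_L] S.subst_inverse[OF p_in_L]
          S.subst_deriv p) (simp add: scale_der_def)
    then show ?thesis using g by (simp add: scale_der_def)
  qed
  have "S.\<sigma> ((\<delta> ^^ k) (x $ i)) = (\<delta> ^^ k) ((h *v x + h0) $ i)" for k
    by (induction k) (simp_all add: S.subst_var \<sigma>\<delta>[OF \<delta>_iter_x_L] del: vector_add_component)
  then have "S.\<sigma> ((\<delta> ^^ Suc k) (x $ i)) = (\<delta> ^^ Suc k) ((h *v x + h0) $ i)" by blast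
  also have "(h *v x + h0) $ i = (\<Sum>j\<in>UNIV. h $ i $ j * x $ j) + h0 $ i"
    by (simp add: matrix_vector_mult_def)
  also have "(\<delta> ^^ Suc k) \<dots> = (\<Sum>j\<in>UNIV. h $ i $ j * (\<delta> ^^ Suc k) (x $ j)) + (\<delta> ^^ Suc k) (h0 $ i)"
    by (simp only: derivation_iter_add[OF derivation_\<delta>] derivation_iter_sum[OF derivation_\<delta>]
        derivation_iter_const_mult[OF derivation_\<delta> \<delta>_C[OF H_entry_matrix[OF h]]])
  \<comment> \<open>The translation disappears because the order is positive.\<close>
  also have "(\<delta> ^^ Suc k) (h0 $ i) = 0"
    using \<delta>_C[OF H_entry_vector[OF h]] derivation_zero[OF derivation_\<delta>]
    by (induction k) simp_all
  finally show ?thesis by simp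
qed

text \<open>One monic equation satisfied by all coordinates simultaneously. It involves derivatives
  of positive order only, since these transform by \<open>h\<close> alone.\<close>

definition linear_rel :: "nat \<Rightarrow> (nat \<Rightarrow> 'a) \<Rightarrow> bool" where
  "linear_rel r a \<longleftrightarrow> (\<forall>l<r. a l \<in> L) \<and>
     (\<forall>i. (\<delta> ^^ Suc r) (x $ i) = (\<Sum>l<r. a l * (\<delta> ^^ Suc l) (x $ i)))"

text \<open>Division by the last nonzero coefficient. The order obtained is strictly below the
  number of coefficients, which is what contradicts minimality later.\<close>

lemma linear_rel_of_solution:
  assumes s: "\<forall>l<m. s l \<in> L" "\<exists>l<m. s l \<noteq> 0" "\<forall>i. (\<Sum>l<m. s l * (\<delta> ^^ Suc l) (x $ i)) = 0"
  shows "\<exists>r<m. \<exists>a. linear_rel r a"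
proof -
  define r where "r = Max {l. l < m \<and> s l \<noteq> 0}"
  have fin: "finite {l. l < m \<and> s l \<noteq> 0}" by simp
  have "r \<in> {l. l < m \<and> s l \<noteq> 0}" unfolding r_def using s(2) by (intro Max_in fin) auto
  then have r: "r < m" "s r \<noteq> 0" by auto
  have big: "s l = 0" if "r < l" "l < m" for l
  proof (rule ccontr)
    assume "s l \<noteq> 0"
    then have "l \<le> r" unfolding r_def using that fin by (intro Max_ge) auto
    then show False using that by simp
  qed
  have "linear_rel r (\<lambda>l. - s l / s r)"
    unfolding linear_rel_def
  proof (intro conjI allI impI)
    fix l assume "l < r"
    then show "- s l / s r \<in> L"
      using s(1) r(1) by (intro subfield_divide[OF subfield_L] subring_uminus[OF subring_L]) auto
  next
    fix i
    let ?X = "\<lambda>l. (\<delta> ^^ Suc l) (x $ i)"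
    have "(\<Sum>l<m. s l * ?X l) = (\<Sum>l<Suc r. s l * ?X l)"
      using r(1) big by (intro sum.mono_neutral_right) auto
    then have "s r * ?X r = - (\<Sum>l<r. s l * ?X l)"
      using s(3) by (simp add: eq_neg_iff_add_eq_0 add.commute del: funpow.simps)
    then have "?X r = - (\<Sum>l<r. s l * ?X l) / s r"
      unfolding eq_divide_eq using r(2) by (simp only: mult.commute simp_thms if_True)
    then show "?X r = (\<Sum>l<r. - s l / s r * ?X l)"
      by (simp add: sum_divide_distrib sum_negf del: funpow.simps)
  qed
  then show ?thesis using r(1) by blast
qed

text \<open>A relation of minimal order is unique, hence fixed by all the substitutions.\<close>

lemma invariant_linear_rel: "\<exists>r a. (\<forall>l<r. a l \<in> K) \<and> linear_rel r a"
proof -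
  let ?X = "\<lambda>l i. (\<delta> ^^ Suc l) (x $ i)"
  \<comment> \<open>One unknown more than there are coordinates, hence more unknowns than
    equations.\<close>
  have "\<exists>s. (\<forall>l\<in>{..<Suc CARD('n)}. s l \<in> L) \<and> (\<exists>l\<in>{..<Suc CARD('n)}. s l \<noteq> 0) \<and>
      (\<forall>i\<in>(UNIV :: 'n set). (\<Sum>l<Suc CARD('n). ?X l i * s l) = 0)"
    by (rule homogeneous_system[OF subfield_L]) (simp_all add: \<delta>_iter_x_L \<delta>_L)
  then obtain s where "\<forall>l<Suc CARD('n). s l \<in> L" "\<exists>l<Suc CARD('n). s l \<noteq> 0"
    "\<forall>i. (\<Sum>l<Suc CARD('n). s l * ?X l i) = 0"
    by (auto simp: mult.commute)
  from linear_rel_of_solution[OF this] have ex: "\<exists>r. \<exists>a. linear_rel r a" by blast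
  define r where "r = (LEAST r. \<exists>a. linear_rel r a)"
  obtain a where a: "linear_rel r a" unfolding r_def using LeastI_ex[OF ex] by blast
  have min: "\<not> linear_rel r' b" if "r' < r" for r' b
    using not_less_Least[of r' "\<lambda>r. \<exists>a. linear_rel r a"] that unfolding r_def by blast
  have aL: "a l \<in> L" if "l < r" for l using a that by (simp add: linear_rel_def)
  have "\<tau> g h h0 (a l) = a l" if g: "g \<in> F - {0}" and h: "(h, h0) \<in> H" and l: "l < r" for g h h0 l
  proof (rule ccontr)
    assume neq: "\<tau> g h h0 (a l) \<noteq> a l"
    interpret S: diff_substitution d "scale_der g d" C x "h *v x + h0" by (rule diff_substitution_H[OF g h])
    define b where "b l = a l - S.\<sigma> (a l)" for l
    \<comment> \<open>Applying the substitution to the relation and subtracting cancels the leading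
      terms up to \<open>h\<close>, so \<open>h *v v\<close> is zero; invertibility of
      \<open>h\<close> gives \<open>v = 0\<close>.\<close>
    define v :: "'a^'n" where "v = (\<chi> j. \<Sum>l<r. b l * ?X l j)"
    have "(h *v v) $ i = 0" for i
    proof -
      have "S.\<sigma> (?X r i) = S.\<sigma> (\<Sum>l<r. a l * ?X l i)" using a by (simp only: linear_rel_def)
      also have "\<dots> = (\<Sum>l<r. S.\<sigma> (a l * ?X l i))"
        by (rule S.subst_sum) (simp add: subring_mult[OF subring_L] aL \<delta>_iter_x_L \<delta>_L)
      also have "\<dots> = (\<Sum>l<r. S.\<sigma> (a l) * S.\<sigma> (?X l i))"
        by (rule sum.cong) (auto simp only: S.subst_mult[OF aL \<delta>_iter_x_L] lessThan_iff)
      finally have "(\<Sum>j\<in>UNIV. h $ i $ j * ?X r j) = (\<Sum>l<r. S.\<sigma> (a l) * (\<Sum>j\<in>UNIV. h $ i $ j * ?X l j))"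
        by (simp only: subst_\<delta>_iter_x[OF g h])
      also have "\<dots> = (\<Sum>j\<in>UNIV. \<Sum>l<r. S.\<sigma> (a l) * (h $ i $ j * ?X l j))"
        unfolding sum_distrib_left by (rule sum.swap)
      finally have 1: "(\<Sum>j\<in>UNIV. h $ i $ j * ?X r j) = (\<Sum>j\<in>UNIV. h $ i $ j * (\<Sum>l<r. S.\<sigma> (a l) * ?X l j))"
        by (simp add: sum_distrib_left mult.left_commute del: funpow.simps)
      have "(h *v v) $ i = (\<Sum>j\<in>UNIV. h $ i $ j * (\<Sum>l<r. b l * ?X l j))"
        by (simp add: matrix_vector_mult_def v_def del: funpow.simps)
      also have "\<dots> = (\<Sum>j\<in>UNIV. h $ i $ j * ?X r j) - (\<Sum>j\<in>UNIV. h $ i $ j * (\<Sum>l<r. S.\<sigma> (a l) * ?X l j))"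
      proof -
        have "(\<Sum>l<r. b l * ?X l j) = ?X r j - (\<Sum>l<r. S.\<sigma> (a l) * ?X l j)" for j
        proof -
          have "?X r j = (\<Sum>l<r. a l * ?X l j)" using a by (simp only: linear_rel_def)
          then show ?thesis by (simp add: b_def left_diff_distrib sum_subtractf del: funpow.simps)
        qed
        then show ?thesis by (simp only: right_diff_distrib sum_subtractf)
      qed
      finally show ?thesis using 1 by simp
    qed
    then have "h *v v = 0" by (simp add: vec_eq_iff)
    obtain k where k: "k ** h = mat 1" using H_inverse[OF h] by blast
    have "v = k *v (h *v v)" by (simp only: matrix_vector_mul_assoc k matrix_vector_mul_lid)
    then have "v = 0" using \<open>h *v v = 0\<close> by simp
    then have zero: "(\<Sum>l<r. ?X l j * b l) = 0" for j
      by (simp add: v_def vec_eq_iff mult.commute del: funpow.simps)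
    \<comment> \<open>The differences \<open>b l\<close> solve the system but need not lie in
      \<open>L\<close>. Its coefficients do, so a nonzero solution exists over \<open>L\<close> too
      and yields a relation of smaller order.\<close>
    have "\<exists>s. (\<forall>l\<in>{..<r}. s l \<in> L) \<and> (\<exists>l\<in>{..<r}. s l \<noteq> 0) \<and>
        (\<forall>i\<in>(UNIV :: 'n set). (\<Sum>l<r. ?X l i * s l) = 0)"
    proof (rule homogeneous_system[OF subfield_L])
      have "b l \<noteq> 0" using neq by (simp add: b_def)
      then show "card (UNIV :: 'n set) < card {..<r} \<or>
        (\<exists>s. (\<exists>l\<in>{..<r}. s l \<noteq> 0) \<and> (\<forall>i\<in>(UNIV :: 'n set). (\<Sum>l<r. ?X l i * s l) = 0))"
        using zero l by (intro disjI2 exI[of _ b]) (auto simp del: funpow.simps)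
    qed (simp_all add: \<delta>_iter_x_L \<delta>_L)
    then obtain s where "\<forall>l<r. s l \<in> L" "\<exists>l<r. s l \<noteq> 0" "\<forall>i. (\<Sum>l<r. s l * ?X l i) = 0"
      by (auto simp: mult.commute)
    from linear_rel_of_solution[OF this] show False using min by blast
  qed
  then have "a l \<in> K" if "l < r" for l
    using aL that unfolding diff_invariants_def by blast
  then show ?thesis using a by blast
qed

lemma maximal_invariants_card:
  assumes S: "maximal_diff_alg_independent \<delta> K C S" and fin: "finite S"
  shows "CARD('n) \<le> Suc (card S)"
proof -
  have S': "S \<subseteq> K" "diff_alg_independent \<delta> C id S"
    "\<And>T. S \<subseteq> T \<Longrightarrow> T \<subseteq> K \<Longrightarrow> diff_alg_independent \<delta> C id T \<Longrightarrow> T = S"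
    using S by (simp_all add: maximal_diff_alg_independent_def)
  obtain r a where ra: "\<forall>l<r. a l \<in> K" "linear_rel r a" using invariant_linear_rel by blast
  have "\<exists>q \<rho>. (\<delta> ^^ \<rho>) (a l) \<in> der_closure C (jets \<delta> id S q \<union> jets \<delta> id {a l} \<rho>)" if "l < r" for l
  \<comment> \<open>By maximality \<open>a l\<close> is either a member of \<open>S\<close>, where
    order \<open>0\<close> suffices, or dependent on it.\<close>
  proof (cases "diff_alg_independent \<delta> C id (insert (a l) S)")
    case True
    then have "a l \<in> S" using S'(3)[of "insert (a l) S"] S'(1) ra(1) that by blast
    then have "(\<delta> ^^ 0) (a l) \<in> jets \<delta> id S 1 \<union> jets \<delta> id {a l} 0"
      using jetsI[of "a l" S 0 1 \<delta> id] by simp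
    then show ?thesis using der_closure_incl by blast
  next
    case False
    then show ?thesis by (rule diff_dependent_insert_jet[OF subring_C S'(2)])
  qed
  then obtain q \<rho> where q\<rho>: "\<And>l. l < r \<Longrightarrow>
      (\<delta> ^^ \<rho> l) (a l) \<in> der_closure C (jets \<delta> id S (q l) \<union> jets \<delta> id {a l} (\<rho> l))"
    by metis
  define Q where "Q = Max (q ` {..<r} \<union> {0})"
  have qQ: "q l \<le> Q" if "l < r" for l unfolding Q_def using that by (intro Max_ge) auto
  \<comment> \<open>All initial jets, of the coefficients and of \<open>x\<close>, in one finite set
    independent of \<open>k\<close>; beyond it only the jets of \<open>S\<close> grow.\<close>
  define A0 where "A0 = (\<Union>l<r. jets \<delta> id {a l} (\<rho> l)) \<union> jets \<delta> (($) x) UNIV (Suc r)"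
  have finA0: "finite A0" unfolding A0_def by (simp add: finite_jets)
  define B where "B k = jets \<delta> id S (Q + k) \<union> A0" for k
  have a_B: "(\<delta> ^^ j) (a l) \<in> der_closure C (B k)" if "l < r" "j \<le> k" for l j k
  proof -
    have "(\<delta> ^^ j) (a l) \<in> der_closure C (jets \<delta> id S (q l + j) \<union> jets \<delta> id {a l} (\<rho> l))"
      by (rule der_closure_jets_tail[OF derivation_\<delta> \<delta>_C_closed q\<rho>[OF that(1)]])
    moreover have "jets \<delta> id S (q l + j) \<union> jets \<delta> id {a l} (\<rho> l) \<subseteq> B k"
      unfolding B_def
    proof (rule Un_mono)
      show "jets \<delta> id S (q l + j) \<subseteq> jets \<delta> id S (Q + k)"
        using qQ[OF that(1)] that(2) by (intro jets_mono) auto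
      show "jets \<delta> id {a l} (\<rho> l) \<subseteq> A0" unfolding A0_def using that(1) by blast
    qed
    ultimately show ?thesis using der_closure_mono by blast
  qed
  have x_rel: "(\<delta> ^^ Suc r) (x $ i) \<in>
      der_closure C (jets \<delta> a {..<r} 1 \<union> jets \<delta> id {x $ i} (Suc r))" (is "_ \<in> der_closure C ?A") for i
  proof -
    have "(\<Sum>l<r. a l * (\<delta> ^^ Suc l) (x $ i)) \<in> der_closure C ?A"
    proof (intro subring_sum subring_mult is_subring_der_closure)
      fix l assume l: "l \<in> {..<r}"
      have "a l \<in> ?A" using jetsI[of l "{..<r}" 0 1 \<delta> a] l by simp
      moreover have "(\<delta> ^^ Suc l) (x $ i) \<in> ?A" using l by (simp add: jets_id_singleton del: funpow.simps)
      ultimately show "a l \<in> der_closure C ?A" "(\<delta> ^^ Suc l) (x $ i) \<in> der_closure C ?A"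
        using der_closure_incl[of ?A C] by auto
    qed
    then show ?thesis using ra(2) by (simp only: linear_rel_def)
  qed
  have x_B: "jets \<delta> (($) x) UNIV k \<subseteq> der_closure C (B k)" for k
  proof
    fix b assume "b \<in> jets \<delta> (($) x) UNIV k"
    then obtain i j where j: "j < k" "b = (\<delta> ^^ j) (x $ i)" by (rule jetsE)
    have "b \<in> der_closure C (jets \<delta> a {..<r} (1 + j) \<union> jets \<delta> id {x $ i} (Suc r))"
      unfolding j(2) by (rule der_closure_jets_tail[OF derivation_\<delta> \<delta>_C_closed x_rel])
    moreover have "jets \<delta> a {..<r} (1 + j) \<subseteq> der_closure C (B k)"
    proof
      fix c assume "c \<in> jets \<delta> a {..<r} (1 + j)"
      then obtain l j' where "l \<in> {..<r}" "j' < 1 + j" "c = (\<delta> ^^ j') (a l)" by (rule jetsE)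
      then show "c \<in> der_closure C (B k)" using a_B[of l j' k] j(1) by simp
    qed
    moreover have "jets \<delta> id {x $ i} (Suc r) \<subseteq> der_closure C (B k)"
    proof
      fix c assume "c \<in> jets \<delta> id {x $ i} (Suc r)"
      then obtain j' where "j' < Suc r" "c = (\<delta> ^^ j') (x $ i)" by (auto elim: jetsE)
      then have "c \<in> B k" unfolding B_def A0_def using jetsI[of i UNIV j' "Suc r" \<delta> "($) x"] by simp
      then show "c \<in> der_closure C (B k)" by (rule subsetD[OF der_closure_incl])
    qed
    ultimately show "b \<in> der_closure C (B k)" using der_closure_trans[of _ C "B k" b] by (metis Un_least)
  qed
  \<comment> \<open>Each application of \<open>d\<close> is a \<delta>-step followed by
    multiplication with \<open>p\<close>, so the \<open>d\<close>-jets of \<open>x\<close> need the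
    \<delta>-jets of \<open>p\<close> up to the same order; these account for one extra unit of
    slope.\<close>
  define G where "G m = jets \<delta> (($) x) UNIV m \<union> jets \<delta> id {p} m" for m
  have G_mono: "G l \<subseteq> G m" if "l \<le> m" for l m
    unfolding G_def using that by (intro Un_mono jets_mono) auto
  have d_G: "(d ^^ j) (x $ i) \<in> der_closure C (G (Suc j))" for i j
  proof (induction j)
    case 0
    have "x $ i \<in> G (Suc 0)" unfolding G_def using jetsI[of i UNIV 0 "Suc 0" \<delta> "($) x"] by simp
    then show ?case using der_closure_incl[of "G (Suc 0)" C] by auto
  next
    case (Suc j)
    have "\<delta> ` G (Suc j) \<subseteq> G (Suc (Suc j))"
      unfolding G_def image_Un by (intro Un_mono jets_derivation)
    then have "G (Suc j) \<union> \<delta> ` G (Suc j) \<subseteq> G (Suc (Suc j))" using G_mono[of "Suc j" "Suc (Suc j)"] by simp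
    moreover have "\<delta> ((d ^^ j) (x $ i)) \<in> der_closure C (G (Suc j) \<union> \<delta> ` G (Suc j))"
      by (rule der_closure_derivation[OF derivation_\<delta> \<delta>_C_closed Suc])
    ultimately have "\<delta> ((d ^^ j) (x $ i)) \<in> der_closure C (G (Suc (Suc j)))"
      using der_closure_mono by blast
    moreover have "p \<in> G (Suc (Suc j))"
      unfolding G_def using jetsI[of p "{p}" 0 "Suc (Suc j)" \<delta> id] by simp
    ultimately show ?case
      using subring_mult[OF is_subring_der_closure, of p C "G (Suc (Suc j))"] der_closure_incl[of "G (Suc (Suc j))" C]
      by (auto simp: d_eq_\<delta>[of "(d ^^ j) (x $ i)"])
  qed
  have dx: "jets d (($) x) UNIV k \<subseteq> der_closure C (B k \<union> jets \<delta> id {p} k)" for k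
  proof
    fix b assume "b \<in> jets d (($) x) UNIV k"
    then obtain i j where j: "j < k" "b = (d ^^ j) (x $ i)" by (rule jetsE)
    then have "b \<in> der_closure C (G k)"
      using d_G[of j i] der_closure_mono[OF G_mono[of "Suc j" k], of C] by auto
    moreover have "G k \<subseteq> der_closure C (B k \<union> jets \<delta> id {p} k)"
      unfolding G_def
    proof (rule Un_least)
      show "jets \<delta> (($) x) UNIV k \<subseteq> der_closure C (B k \<union> jets \<delta> id {p} k)"
        using x_B[of k] der_closure_mono[of "B k" "B k \<union> jets \<delta> id {p} k" C] by blast
      show "jets \<delta> id {p} k \<subseteq> der_closure C (B k \<union> jets \<delta> id {p} k)"
        using der_closure_incl[of "B k \<union> jets \<delta> id {p} k" C] by blast
    qed
    ultimately show "b \<in> der_closure C (B k \<union> jets \<delta> id {p} k)" by (rule der_closure_trans[rotated])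
  qed
  have bound: "CARD('n) * k \<le> card S * (Q + k) + card A0 + k" for k
  proof -
    have "CARD('n) * k \<le> card (B k \<union> jets \<delta> id {p} k)"
      using diff_independent_card_le[OF subring_C x_independent_C _ _ dx[of k]]
      by (simp add: B_def finA0 fin finite_jets)
    also have "\<dots> \<le> card (B k) + card (jets \<delta> id {p} k)" by (rule card_Un_le)
    also have "card (B k) \<le> card (jets \<delta> id S (Q + k)) + card A0" unfolding B_def by (rule card_Un_le)
    finally have "CARD('n) * k \<le> card (jets \<delta> id S (Q + k)) + card A0 + card (jets \<delta> id {p} k)"
      by (simp only: add_le_mono1)
    moreover have "card (jets \<delta> id {p} k) \<le> k" using card_jets_le[of "{p}" \<delta> id k] by simp
    ultimately show ?thesis using card_jets_le[OF fin, of \<delta> id "Q + k"] by linarith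
  qed
  show ?thesis
  proof (rule ccontr)
    assume "\<not> ?thesis"
    then have "Suc (Suc (card S)) \<le> CARD('n)" by simp
    \<comment> \<open>One more than the constant part of the bound, so that the excess in slope
      gives a contradiction.\<close>
    define k where "k = Suc (card S * Q + card A0)"
    have "Suc (Suc (card S)) * k \<le> CARD('n) * k"
      using \<open>Suc (Suc (card S)) \<le> CARD('n)\<close> by (rule mult_le_mono1)
    also have "\<dots> \<le> card S * (Q + k) + card A0 + k" by (rule bound)
    finally show False by (simp add: k_def algebra_simps)
  qed
qed

section \<open>Existence and size of maximal systems\<close>

lemma has_diff_trdeg_invariants: "has_diff_trdeg \<delta> K C (CARD('n) - 1)"
proof -
  have fin: "finite S \<and> card S < CARD('n)" if S: "S \<subseteq> K" "diff_alg_independent \<delta> C id S" for S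
  proof (cases "finite S")
    case True
    then show ?thesis using independent_invariants_card[OF S] by blast
  next
    case False
    \<comment> \<open>The upper bound was proved for finite systems; an infinite one would contain a
      finite subsystem that is already too large.\<close>
    then obtain T where T: "T \<subseteq> S" "finite T" "card T = CARD('n)"
      using infinite_arbitrarily_large by blast
    have "card T < CARD('n)"
      using T S by (intro independent_invariants_card diff_alg_independent_mono[OF S(2)]) auto
    then show ?thesis using T(3) by simp
  qed
  have "\<exists>S. maximal_diff_alg_independent \<delta> K C S"
  proof -
    let ?P = "\<lambda>S. S \<subseteq> K \<and> diff_alg_independent \<delta> C id S"
    \<comment> \<open>A dependent family would have a member whose jet is the leader, and the empty
      family has none. A system of greatest size is then maximal for inclusion.\<close>
    have "?P {}" using diff_dependent_top_jet[OF subring_C, of \<delta> id "{}"] by blast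
    then obtain S where S: "?P S" "\<And>T. ?P T \<Longrightarrow> card T \<le> card S"
      using ex_has_greatest_nat[of ?P "{}" card "CARD('n)"] fin by (metis less_imp_le)
    have "T = S" if "S \<subseteq> T" "?P T" for T
      using card_seteq[of T S] fin[of T] S(2)[OF that(2)] that by blast
    then have "maximal_diff_alg_independent \<delta> K C S"
      using S(1) by (auto simp: maximal_diff_alg_independent_def)
    then show ?thesis by blast
  qed
  moreover have "finite S \<and> card S = CARD('n) - 1" if "maximal_diff_alg_independent \<delta> K C S" for S
  proof -
    have "finite S" "card S < CARD('n)"
      using fin[of S] that by (auto simp: maximal_diff_alg_independent_def)
    then show ?thesis using maximal_invariants_card[OF that] by simp
  qed
  ultimately show ?thesis unfolding has_diff_trdeg_def by blast
qed

end

theorem theorem2: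
  fixes d :: "'a::field_char_0 \<Rightarrow> 'a"
    and F :: "'a set"
    and x :: "'a^'n"
    and H :: "(('a^'n^'n) \<times> ('a^'n)) set"
    and p :: 'a
  assumes "derivation d"
    and "differential_subfield d F"
    and "constants d F \<noteq> F"
    and "CARD('n) > 1"
    and "diff_alg_independent d F (($) x) UNIV"
    and "subgroup H (affine_group (constants d F))"
    and "p \<in> diff_rat_functions d (constants d F) x"
    and "p \<noteq> 0"
    and "\<forall>g \<in> F - {0}. \<forall>(h, h0) \<in> H.
           diff_subst d (constants d F) x (scale_der g d) (h *v x + h0) p = inverse g * p"
  shows "has_diff_trdeg (scale_der p d) (diff_invariants d F H x) (constants d F) (CARD('n) - 1)"
proof -
  interpret relative_invariant d F x H p
    by (rule relative_invariant.intro) (fact assms)+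
  show ?thesis by (rule has_diff_trdeg_invariants)
qed

end
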